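(* Let $J,R,Q\in\mathbb{R}^{n\times n}$ with $J$ skew-symmetric, $R$ symmetric positive semidefinite, $Q$ symmetric positive definite, let $B\in\mathbb{R}^{n\times m}$ have full rank $m\le n$, and let $\mathbb{U}=[\underline{u}_1,\overline{u}_1]\times\dots\times[\underline{u}_m,\overline{u}_m]\subset\mathbb{R}^m$ with $0\in\operatorname{int}(\mathbb{U})$. For $T>0$, $x^0,x_T\in\mathbb{R}^n$ consider the optimal control problem $$\min_{u\in L^1(0,T;\mathbb{U})}\int_0^T u(t)^\top y(t)\,dt\quad\text{s.t.}\quad \dot x(t)=(J-R)Qx(t)+Bu(t),\ \ x(0)=x^0,\ x(T)=x_T,\ \ y(t)=B^\top Qx(t).\tag{OCP}$$ Then (OCP) is strictly dissipative with respect to the subspace $\ker(R^{1/2}Q)$. Moreover, assume that $((J-R)Q,B)$ is controllable, i.e. $\operatorname{rank}(B,AB,\dots,A^{n-1}B)=n$ for $A=(J-R)Q$, and that $x_T$ is reachable from $0$, i.e. there are $T_2\ge 0$ and $u_2\in L^1(0,T_2;\mathbb{U})$ such that the solution of $\dot x=(J-R)Qx+Bu_2$, $x(0)=0$, satisfies $x(T_2)=x_T$. Then optimal trajectories of (OCP) exhibit the following subspace turnpike behaviour: for every compact set $K\subset\mathbb{R}^n$ and every $\varepsilon>0$ there is a constant $C_{K,\varepsilon}>0$, independent of $T$, such that for every horizon $T$ and every optimal state trajectory $x^\star$ of (OCP) with initial value $x^0\in K$, $$\mu\big[\{t\in[0,T]:\operatorname{dist}(x^\star(t),\ker(R^{1/2}Q))\ge\varepsilon\}\big]<C_{K,\varepsilon},$$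 where $\mu$ denotes Lebesgue measure on $\mathbb{R}$.
   Context: $L^1(0,T;\mathbb{U})$ is the set of Lebesgue-measurable, integrable functions on $(0,T)$ with values in $\mathbb{U}$; differential equations hold almost everywhere with solutions in $W^{1,1}(0,T;\mathbb{R}^n)$. $\operatorname{dist}(x,\mathcal{V})=\inf_{v\in\mathcal{V}}\|v-x\|$. $\mathcal{K}$ denotes the set of continuous and strictly increasing functions $\alpha:[0,\infty)\to[0,\infty)$ with $\alpha(0)=0$. Strict dissipativity with respect to a subspace: let $\ell:\mathbb{R}^n\times\mathbb{R}^m\to\mathbb{R}$ be a running cost. An optimal control problem $\min_{u\in L^1(0,T;\mathbb{U})}\int_0^T\ell(x(t),u(t))\,dt$ s.t. $\dot x=Ax+Bu$, $x(0)=x^0$, $x(T)=x_T$, is called strictly dissipative with respect to a subspace $\mathcal{V}\subset\mathbb{R}^n$ if there exist a storage function $S:\mathbb{R}^n\to[0,\infty)$ and a function $\alpha\in\mathcal{K}$ such that all optimal controls $u^\star\in L^1(0,T;\mathbb{U})$ and associated states $x^\star\in W^{1,1}(0,T;\mathbb{R}^n)$ satisfy $$S(x_T)-S(x^0)\le\int_0^T\ell(x^\star(t),u^\star(t))-\alpha(\operatorname{dist}(x^\star(t),\mathcal{V}))\,dt.$$ For (OCP) the running cost is $\ell(x,u)=u^\top B^\top Qx$. *)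

theory Defs
  imports "HOL-Analysis.Analysis"
begin

definition pos_semidef :: "real^'n^'n \<Rightarrow> bool" where
  "pos_semidef M \<longleftrightarrow> transpose M = M \<and> (\<forall>x. 0 \<le> x \<bullet> (M *v x))"

definition pos_def :: "real^'n^'n \<Rightarrow> bool" where
  "pos_def M \<longleftrightarrow> transpose M = M \<and> (\<forall>x. x \<noteq> 0 \<longrightarrow> 0 < x \<bullet> (M *v x))"

definition matrix_sqrt :: "real^'n^'n \<Rightarrow> real^'n^'n" where
  "matrix_sqrt M = (THE S. pos_semidef S \<and> S ** S = M)"

definition matrix_ker :: "real^'n^'m \<Rightarrow> (real^'n) set" where
  "matrix_ker M = {x. M *v x = 0}"

text \<open>\<^term>\<open>((**) A ^^ k) B\<close> is the block $A^k B$; the dimension of the span of the columns of all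
  blocks is the (column) rank of the block matrix $(B, AB, \dots, A^{n-1}B)$.\<close>

definition controllable :: "real^'n^'n \<Rightarrow> real^'m^'n \<Rightarrow> bool" where
  "controllable A B \<longleftrightarrow> dim (\<Union>k<CARD('n). columns (((**) A ^^ k) B)) = CARD('n)"

definition L1_controls :: "real \<Rightarrow> (real^'m) set \<Rightarrow> (real \<Rightarrow> real^'m) set" where
  "L1_controls T U = {u. set_integrable lebesgue {0<..<T} u \<and> (\<forall>t\<in>{0<..<T}. u t \<in> U)}"

text \<open>Sobolev space $W^{1,1}(0,T)$ in one dimension, defined by testing against $C^1_c(0,T)$.\<close>

definition test_functions :: "real \<Rightarrow> (real \<Rightarrow> real) set" where
  "test_functions T = {\<phi>. \<phi> C1_differentiable_on UNIV \<and>
     (\<exists>a b. 0 < a \<and> b < T \<and> (\<forall>t. t \<notin> {a..b} \<longrightarrow> \<phi> t = 0))}"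

definition weak_derivative :: "real \<Rightarrow> (real \<Rightarrow> real^'n) \<Rightarrow> (real \<Rightarrow> real^'n) \<Rightarrow> bool" where
  "weak_derivative T x x' \<longleftrightarrow>
     set_integrable lebesgue {0<..<T} x \<and> set_integrable lebesgue {0<..<T} x' \<and>
     (\<forall>\<phi>\<in>test_functions T.
        (LINT t:{0<..<T}|lebesgue. deriv \<phi> t *\<^sub>R x t) = - (LINT t:{0<..<T}|lebesgue. \<phi> t *\<^sub>R x' t))"

text \<open>The point values of a $W^{1,1}$ function are those of its continuous representative, which
  is singled out by continuity on the closed interval.\<close>

definition state_trajectory ::
  "real^'n^'n \<Rightarrow> real^'m^'n \<Rightarrow> real \<Rightarrow> real^'n \<Rightarrow> (real \<Rightarrow> real^'m) \<Rightarrow> (real \<Rightarrow> real^'n) \<Rightarrow> bool" where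
  "state_trajectory A B T x0 u x \<longleftrightarrow>
     continuous_on {0..T} x \<and> x 0 = x0 \<and>
     (\<exists>x'. weak_derivative T x x' \<and>
           (AE t in lebesgue. t \<in> {0<..<T} \<longrightarrow> x' t = A *v x t + B *v u t))"

definition reachable_from_zero ::
  "real^'n^'n \<Rightarrow> real^'m^'n \<Rightarrow> (real^'m) set \<Rightarrow> real^'n \<Rightarrow> bool" where
  "reachable_from_zero A B U xT \<longleftrightarrow>
     (\<exists>T\<ge>0. \<exists>u\<in>L1_controls T U. \<exists>x. state_trajectory A B T 0 u x \<and> x T = xT)"

definition admissible ::
  "real^'n^'n \<Rightarrow> real^'m^'n \<Rightarrow> (real^'m) set \<Rightarrow> real \<Rightarrow> real^'n \<Rightarrow> real^'n
    \<Rightarrow> (real \<Rightarrow> real^'m) \<Rightarrow> (real \<Rightarrow> real^'n) \<Rightarrow> bool" where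
  "admissible A B U T x0 xT u x \<longleftrightarrow>
     u \<in> L1_controls T U \<and> state_trajectory A B T x0 u x \<and> x T = xT"

definition total_cost ::
  "(real^'n \<Rightarrow> real^'m \<Rightarrow> real) \<Rightarrow> real \<Rightarrow> (real \<Rightarrow> real^'m) \<Rightarrow> (real \<Rightarrow> real^'n) \<Rightarrow> real" where
  "total_cost l T u x = (LINT t:{0<..<T}|lebesgue. l (x t) (u t))"

definition optimal ::
  "(real^'n \<Rightarrow> real^'m \<Rightarrow> real) \<Rightarrow> real^'n^'n \<Rightarrow> real^'m^'n \<Rightarrow> (real^'m) set \<Rightarrow> real \<Rightarrow> real^'n \<Rightarrow> real^'n
    \<Rightarrow> (real \<Rightarrow> real^'m) \<Rightarrow> (real \<Rightarrow> real^'n) \<Rightarrow> bool" where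
  "optimal l A B U T x0 xT u x \<longleftrightarrow>
     admissible A B U T x0 xT u x \<and>
     (\<forall>v z. admissible A B U T x0 xT v z \<longrightarrow> total_cost l T u x \<le> total_cost l T v z)"

definition class_K :: "(real \<Rightarrow> real) set" where
  "class_K = {\<alpha>. continuous_on {0..} \<alpha> \<and> strict_mono_on {0..} \<alpha> \<and> \<alpha> 0 = 0}"

text \<open>The storage function and the class-K function belong to the system, the constraints and the
  running cost, so they are chosen before the horizon and the boundary values. (Choosing them
  separately for each triple of horizon, initial and terminal state would be weaker: the
  inequality involves the storage function only at the two boundary values, so for distinct
  boundary values it could be satisfied by adjusting these two numbers.)\<close>

definition strictly_dissipative ::
  "(real^'n \<Rightarrow> real^'m \<Rightarrow> real) \<Rightarrow> real^'n^'n \<Rightarrow> real^'m^'n \<Rightarrow> (real^'m) set \<Rightarrow> (real^'n) set \<Rightarrow> bool" where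
  "strictly_dissipative l A B U V \<longleftrightarrow> subspace V \<and>
     (\<exists>S \<alpha>. (\<forall>x. 0 \<le> S x) \<and> \<alpha> \<in> class_K \<and>
       (\<forall>T>0. \<forall>x0 xT u x. optimal l A B U T x0 xT u x \<longrightarrow>
          S xT - S x0 \<le> (LINT t:{0<..<T}|lebesgue. l (x t) (u t) - \<alpha> (infdist (x t) V))))"

definition supply_cost :: "real^'m^'n \<Rightarrow> real^'n^'n \<Rightarrow> real^'n \<Rightarrow> real^'m \<Rightarrow> real" where
  "supply_cost B Q x u = u \<bullet> ((transpose B ** Q) *v x)"

end

theory Submission
  imports Defs
begin

text \<open>The Hamiltonian \<open>x\<^sup>T Q x / 2\<close> serves as storage function. Along any trajectory it satisfies the
  balance \<open>d/dt (x\<^sup>T Q x / 2) = u\<^sup>T y - |R\<^sup>1\<^sup>/\<^sup>2 Q x|\<^sup>2\<close>, and the dissipation dominates a multiple of the squared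
  distance to the kernel of \<open>R\<^sup>1\<^sup>/\<^sup>2 Q\<close>; this is strict dissipativity.

  For the turnpike property, an optimal trajectory is compared with one that is steered to the
  origin, rests there, and is finally steered to \<open>x\<^sub>T\<close>. The cost of this competitor does not depend on
  the horizon, so the balance bounds the total dissipation, and Markov's inequality bounds the time
  spent away from the kernel. A constrained control can reach the origin because the free motion is
  bounded in the \<open>Q\<close>-norm: it suffices to shrink the free motion linearly to zero over many unit time
  steps, and the correction needed in each step is small.\<close>

subsection \<open>Self-adjoint operators and the positive semidefinite square root\<close>

text \<open>The definitions speak of weak derivatives and integrable controls, so the balance needs
  a product rule along states known only through integrals. Boundedness of \<open>U\<close> makes
  this elementary: a continuous state and a bounded control give a bounded velocity, the state is
  Lipschitz, and the product rule reduces to the fact that a function with quadratically small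
  increments is constant. The du Bois-Reymond lemma ties the weak formulation to this integral form.

  The obstacle to steering is that \<open>A\<close> may have eigenvalues on the imaginary axis: for
  \<open>R = 0\<close> the energy of the free motion is conserved, so waiting until the state is
  near the origin is no option. What rescues the argument is that the control realising a correction
  is bounded by the correction alone, however large the state is.

  \<open>matrix_sqrt\<close> is a definite description, so existence and uniqueness of the root must
  both be proved before \<open>matrix_sqrt R ** Q\<close> can be handled.\<close>

lemma psd_form_zero_imp_kernel:
  fixes f :: "'a::real_inner \<Rightarrow> 'a"
  assumes f: "linear f" and W: "subspace W" "f ` W \<subseteq> W"
    and sa: "\<And>x y. f x \<bullet> y = x \<bullet> f y"
    and psd: "\<And>x. x \<in> W \<Longrightarrow> 0 \<le> x \<bullet> f x"
    and v: "v \<in> W" "v \<bullet> f v = 0"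
  shows "f v = 0"
proof (rule ccontr)
  assume "f v \<noteq> 0"
  \<comment> \<open>A step against \<open>f v\<close> changes the form by
    \<open>2 * t * a + t\<^sup>2 * b\<close>, which is negative for small negative \<open>t\<close>.
    The minimiser would be \<open>- a / b\<close>; the added 1 keeps the denominator positive when
    \<open>b = 0\<close>.\<close>
  define a b t where "a = f v \<bullet> f v" and "b = f v \<bullet> f (f v)" and "t = - a / (b + 1)"
  have a: "a > 0" using \<open>f v \<noteq> 0\<close> by (simp add: a_def)
  have "f v \<in> W" using W v by blast
  then have b: "b \<ge> 0" using psd by (simp add: b_def)
  have "v + t *\<^sub>R f v \<in> W"
    using W v \<open>f v \<in> W\<close> by (simp add: subspace_add subspace_scale)
  then have "0 \<le> (v + t *\<^sub>R f v) \<bullet> f (v + t *\<^sub>R f v)" by (rule psd)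
  also have "\<dots> = 2 * t * a + t\<^sup>2 * b"
    using v sa[of v "f v"]
    by (simp add: linear_add[OF f] linear_scale[OF f] a_def b_def inner_add_left inner_add_right
        inner_commute power2_eq_square algebra_simps)
  also have "\<dots> = t * (t * b + 2 * a)"
    by (simp add: power2_eq_square algebra_simps)
  also have "\<dots> < 0"
  proof -
    have "t < 0" using a b by (simp add: t_def)
    moreover have "t * b + 2 * a > 0" using a b by (simp add: t_def divide_simps)
    ultimately show ?thesis by (rule mult_neg_pos)
  qed
  finally show False by simp
qed

text \<open>The Rayleigh quotient attains its maximum \<open>c\<close> on the compact unit sphere of
  \<open>W\<close>. Then \<open>c I - f\<close> is positive semidefinite on \<open>W\<close> with
  zero form at the maximiser, so the kernel lemma yields the eigenvector equation without any
  differentiation.\<close>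

lemma self_adjoint_has_top_eigenvector:
  fixes f :: "'a::euclidean_space \<Rightarrow> 'a"
  assumes f: "linear f" and W: "subspace W" "f ` W \<subseteq> W" "W \<noteq> {0}"
    and sa: "\<And>x y. f x \<bullet> y = x \<bullet> f y"
  obtains v c where "v \<in> W" "norm v = 1" "f v = c *\<^sub>R v" "\<And>w. w \<in> W \<Longrightarrow> w \<bullet> f w \<le> c * (w \<bullet> w)"
proof -
  have comp: "compact (W \<inter> sphere 0 1)"
    by (simp add: W closed_Int_compact closed_subspace)
  obtain w0 where w0: "w0 \<in> W" "w0 \<noteq> 0"
    using W subspace_0 by blast
  then have "(1 / norm w0) *\<^sub>R w0 \<in> W \<inter> sphere 0 1"
    using W by (simp add: subspace_scale)
  then have ne: "W \<inter> sphere 0 1 \<noteq> {}" by blast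
  have cont: "continuous_on (W \<inter> sphere 0 1) (\<lambda>x. x \<bullet> f x)"
    using f by (intro continuous_intros linear_continuous_on linear_conv_bounded_linear[THEN iffD1])
  obtain v where v: "v \<in> W" "norm v = 1"
    and vmax: "\<And>y. y \<in> W \<Longrightarrow> norm y = 1 \<Longrightarrow> y \<bullet> f y \<le> v \<bullet> f v"
    using continuous_attains_sup[OF comp ne cont] by auto
  define c where "c = v \<bullet> f v"
  have le: "w \<bullet> f w \<le> c * (w \<bullet> w)" if w: "w \<in> W" for w
  proof (cases "w = 0")
    case False
    let ?y = "(1 / norm w) *\<^sub>R w"
    have "?y \<bullet> f ?y \<le> c"
      unfolding c_def using w W False by (intro vmax) (auto simp: subspace_scale)
    then have "(w \<bullet> f w) / (norm w)\<^sup>2 \<le> c"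
      by (simp add: linear_scale[OF f] power2_eq_square)
    then show ?thesis
      using False by (simp add: divide_simps power2_norm_eq_inner)
  qed simp
  define g where "g = (\<lambda>x. c *\<^sub>R x - f x)"
  have "g v = 0"
  proof (rule psd_form_zero_imp_kernel[where f = g and W = W])
    show "linear g"
      unfolding g_def by (intro linear_compose_sub linear_compose_scale_right linear_ident f)
    show "g ` W \<subseteq> W"
      using W by (auto simp: g_def subspace_diff subspace_scale)
    show "g x \<bullet> y = x \<bullet> g y" for x y
      by (simp add: g_def inner_diff sa)
    show "0 \<le> x \<bullet> g x" if "x \<in> W" for x
      using le[OF that] by (simp add: g_def inner_diff)
    show "v \<bullet> g v = 0"
      using v by (simp add: g_def inner_diff c_def norm_eq_1)
  qed (use v W in auto)
  then show ?thesis
    using that[of v c] v le by (simp add: g_def)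
qed

text \<open>Induction on the dimension: the orthogonal complement of an eigenvector inside
  \<open>W\<close> is again invariant, because \<open>f\<close> is self-adjoint.\<close>

lemma self_adjoint_eigenbasis:
  fixes f :: "'a::euclidean_space \<Rightarrow> 'a"
  assumes f: "linear f" and sa: "\<And>x y. f x \<bullet> y = x \<bullet> f y"
    and "subspace W" "f ` W \<subseteq> W"
  shows "\<exists>E. E \<subseteq> W \<and> pairwise orthogonal E \<and> (\<forall>b\<in>E. norm b = 1 \<and> (\<exists>c. f b = c *\<^sub>R b)) \<and> W \<subseteq> span E"
  using assms(3,4)
proof (induction "dim W" arbitrary: W rule: less_induct)
  case less
  show ?case
  proof (cases "W = {0}")
    case True
    then show ?thesis by (intro exI[of _ "{}"]) auto
  next
    case False
    obtain v c where v: "v \<in> W" "norm v = 1" "f v = c *\<^sub>R v"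
      using self_adjoint_has_top_eigenvector[OF f less.prems False sa] by metis
    define W' where "W' = {w \<in> W. w \<bullet> v = 0}"
    have sub: "subspace W'"
      using less.prems by (auto simp: W'_def subspace_def inner_add_left)
    have inv: "f ` W' \<subseteq> W'"
      using less.prems v by (auto simp: W'_def sa)
    have "v \<notin> W'" using v(2) by (simp add: W'_def dot_square_norm)
    moreover have "W' \<subseteq> W" by (auto simp: W'_def)
    ultimately have "W' \<subset> W" using v(1) by blast
    then have "dim W' < dim W"
      by (metis dim_psubset less.prems(1) span_eq_iff sub)
    from less.hyps[OF this sub inv] obtain E where
      E: "E \<subseteq> W'" "pairwise orthogonal E" "\<forall>b\<in>E. norm b = 1 \<and> (\<exists>c. f b = c *\<^sub>R b)" "W' \<subseteq> span E"
      by blast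
    have "pairwise orthogonal (insert v E)"
      using E by (auto simp: pairwise_insert W'_def orthogonal_def inner_commute)
    moreover have "W \<subseteq> span (insert v E)"
    proof
      fix w assume w: "w \<in> W"
      let ?p = "w - (w \<bullet> v) *\<^sub>R v"
      have "?p \<in> W'"
        using w v less.prems
        by (auto simp: W'_def inner_diff_left dot_square_norm subspace_diff subspace_scale)
      then have "?p \<in> span (insert v E)"
        using E(4) span_mono[of E "insert v E"] by blast
      then have "?p + (w \<bullet> v) *\<^sub>R v \<in> span (insert v E)"
        by (rule span_add) (simp add: span_scale span_base)
      then show "w \<in> span (insert v E)" by simp
    qed
    ultimately show ?thesis
      using E v by (intro exI[of _ "insert v E"]) (auto simp: W'_def)
  qed
qed

section \<open>Square roots of positive semidefinite matrices\<close>

lemma inner_matrix_vector_mult: "x \<bullet> (M *v y) = (transpose M *v x) \<bullet> y"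
  for M :: "real^'n^'m"
  by (simp add: dot_lmul_matrix transpose_matrix_vector)

lemma transpose_matrix_self_adjoint:
  fixes f :: "real^'n \<Rightarrow> real^'n"
  assumes "linear f" and sa: "\<And>x y. f x \<bullet> y = x \<bullet> f y"
  shows "transpose (matrix f) = matrix f"
proof -
  have "adjoint f = f" by (rule adjoint_unique) (simp add: sa)
  then show ?thesis using matrix_adjoint[OF assms(1)] by simp
qed

lemma pos_semidef_sqrt_exists:
  fixes M :: "real^'n^'n"
  assumes M: "pos_semidef M"
  shows "\<exists>S. pos_semidef S \<and> S ** S = M"
proof -
  let ?f = "(*v) M"
  have sa: "?f x \<bullet> y = x \<bullet> ?f y" for x y
    using M by (simp add: inner_matrix_vector_mult pos_semidef_def)
  obtain E where E: "pairwise orthogonal E" "\<And>b. b \<in> E \<Longrightarrow> norm b = 1"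
      "\<And>b. b \<in> E \<Longrightarrow> \<exists>c. ?f b = c *\<^sub>R b" "span E = UNIV"
    using self_adjoint_eigenbasis[of ?f UNIV] sa by (simp add: top.extremum_unique) blast
  have fin: "finite E"
    using E(1) by (rule pairwise_orthogonal_imp_finite)
  have ev: "?f b = (b \<bullet> ?f b) *\<^sub>R b" if b: "b \<in> E" for b
    using E(3)[OF b] E(2)[OF b] by (auto simp: dot_square_norm)
  have orth: "b \<bullet> b' = (if b = b' then 1 else 0)" if "b \<in> E" "b' \<in> E" for b b'
    using E(1,2) that by (auto simp: pairwise_def orthogonal_def dot_square_norm)
  \<comment> \<open>For a unit eigenvector the eigenvalue equals \<open>b \<bullet> ?f b\<close>.
    Using this value avoids choosing eigenvalues and makes them visibly nonnegative.\<close>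
  define s where "s = (\<lambda>b. sqrt (b \<bullet> ?f b))"
  define g where "g = (\<lambda>x. \<Sum>b\<in>E. (s b * (b \<bullet> x)) *\<^sub>R b)"
  have lin: "linear g"
    by (rule linearI)
      (simp_all add: g_def inner_add_right algebra_simps sum.distrib scaleR_sum_right)
  have gsa: "g x \<bullet> y = x \<bullet> g y" for x y
    by (simp add: g_def inner_sum_left inner_sum_right inner_commute mult_ac)
  have gpsd: "0 \<le> x \<bullet> g x" for x
  proof -
    have "x \<bullet> g x = (\<Sum>b\<in>E. s b * (b \<bullet> x)\<^sup>2)"
      by (simp add: g_def inner_sum_right inner_commute power2_eq_square mult_ac)
    also have "\<dots> \<ge> 0"
      using M by (intro sum_nonneg mult_nonneg_nonneg) (auto simp: s_def pos_semidef_def)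
    finally show ?thesis .
  qed
  have gb: "g b = s b *\<^sub>R b" if b: "b \<in> E" for b
  proof -
    have "g b = (\<Sum>b'\<in>E. if b' = b then s b *\<^sub>R b else 0)"
      unfolding g_def using b by (intro sum.cong) (auto simp: orth)
    then show ?thesis using fin b by simp
  qed
  have "g (g x) = ?f x" for x
  proof (rule linear_eq_on_span[where B = E and f = "\<lambda>x. g (g x)" and g = ?f])
    show "linear (\<lambda>x. g (g x))" using linear_compose[OF lin lin] by (simp add: o_def)
    show "g (g b) = ?f b" if b: "b \<in> E" for b
    proof -
      have "g (g b) = (s b * s b) *\<^sub>R b"
        by (simp add: gb[OF b] linear_scale[OF lin])
      also have "s b * s b = b \<bullet> ?f b"
        using M by (simp add: s_def pos_semidef_def)
      finally show ?thesis using ev[OF b] by simp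
    qed
  qed (auto simp: E(4))
  then have "matrix g ** matrix g = M"
    by (simp add: matrix_eq matrix_vector_mul_assoc[symmetric] matrix_works lin)
  moreover have "pos_semidef (matrix g)"
    using gpsd transpose_matrix_self_adjoint[OF lin gsa]
    by (simp add: pos_semidef_def matrix_works lin)
  ultimately show ?thesis by blast
qed

lemma pos_semidef_form_zero:
  assumes "pos_semidef M" "v \<bullet> (M *v v) = 0"
  shows "M *v v = 0"
proof (rule psd_form_zero_imp_kernel[where f = "(*v) M" and W = UNIV])
  show "(M *v x) \<bullet> y = x \<bullet> (M *v y)" for x y
    using assms by (simp add: inner_matrix_vector_mult pos_semidef_def)
qed (use assms in \<open>auto simp: pos_semidef_def\<close>)

text \<open>The top eigenvalue bounds the form, and \<open>ev\<close> forces it to be zero.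
  Uniqueness of the root applies this to a difference of roots and to its negative.\<close>

lemma symmetric_nonpos_form_of_eigenvalues:
  fixes X :: "real^'n^'n"
  assumes "transpose X = X" and ev: "\<And>v c. X *v v = c *\<^sub>R v \<Longrightarrow> c *\<^sub>R v = 0"
  shows "w \<bullet> (X *v w) \<le> 0"
proof -
  have "(UNIV :: (real^'n) set) \<noteq> {0}"
    by (metis UNIV_I singletonD zero_neq_one vec_eq_iff one_index zero_index)
  then obtain v c where v: "norm v = 1" "X *v v = c *\<^sub>R v" "\<And>w. w \<bullet> (X *v w) \<le> c * (w \<bullet> w)"
    using self_adjoint_has_top_eigenvector[of "(*v) X" UNIV]
    by (metis UNIV_I assms(1) inner_matrix_vector_mult matrix_vector_mul_linear subset_UNIV subspace_UNIV)
  have "c = 0" using ev[OF v(2)] v(1) by auto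
  then show ?thesis using v(3)[of w] by simp
qed

text \<open>The difference \<open>X\<close> of two positive semidefinite roots \<open>S\<close>, \<open>P\<close> satisfies \<open>S X + X P = 0\<close>; testing
  this with an eigenvector of \<open>X\<close> shows that \<open>X\<close> has no nonzero eigenvalue.\<close>

lemma pos_semidef_sqrt_unique:
  fixes S P :: "real^'n^'n"
  assumes S: "pos_semidef S" and P: "pos_semidef P" and eq: "S ** S = P ** P"
  shows "S = P"
proof -
  define X where "X = S - P"
  have tX: "transpose X = X"
    using S P by (simp add: X_def pos_semidef_def transpose_def vec_eq_iff)
  have SS: "S *v (S *v v) = P *v (P *v v)" for v
    by (simp add: matrix_vector_mul_assoc eq)
  have Xv: "X *v v = S *v v - P *v v" for v
    by (simp add: X_def matrix_vector_mult_diff_rdistrib)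
  have Xz: "c *\<^sub>R v = 0" if v: "X *v v = c *\<^sub>R v" for v c
  proof (rule ccontr)
    assume nz: "c *\<^sub>R v \<noteq> 0"
    have "0 = v \<bullet> (S *v (X *v v)) + v \<bullet> (X *v (P *v v))"
      by (simp add: Xv SS matrix_vector_mult_diff_distrib inner_diff_right)
    also have "v \<bullet> (X *v (P *v v)) = (X *v v) \<bullet> (P *v v)"
      by (simp add: inner_matrix_vector_mult tX)
    also have "v \<bullet> (S *v (X *v v)) + \<dots> = c * (v \<bullet> (S *v v) + v \<bullet> (P *v v))"
      by (simp add: v matrix_vector_mult_scaleR algebra_simps)
    finally have "v \<bullet> (S *v v) + v \<bullet> (P *v v) = 0" using nz by simp
    moreover have "v \<bullet> (S *v v) \<ge> 0" "v \<bullet> (P *v v) \<ge> 0"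
      using S P by (auto simp: pos_semidef_def)
    ultimately have "S *v v = 0" "P *v v = 0"
      using pos_semidef_form_zero S P by (auto simp: add_nonneg_eq_0_iff)
    then show False using v nz by (simp add: Xv)
  qed
  have le: "w \<bullet> (X *v w) \<le> 0" for w
    using symmetric_nonpos_form_of_eigenvalues[OF tX] Xz by blast
  have neg: "(- X) *v v = - (X *v v)" for v
    by (simp add: vec_eq_iff matrix_vector_mult_def sum_negf)
  have "w \<bullet> ((- X) *v w) \<le> 0" for w
  proof (rule symmetric_nonpos_form_of_eigenvalues)
    show "transpose (- X) = - X" using tX by (simp add: transpose_def vec_eq_iff)
    show "c *\<^sub>R v = 0" if "(- X) *v v = c *\<^sub>R v" for v c
      using Xz[of v "- c"] that by (simp add: neg) (metis minus_minus scaleR_eq_0_iff)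
  qed
  then have ge: "w \<bullet> (X *v w) \<ge> 0" for w
    by (simp add: neg)
  have "X *v w = 0" for w
    using pos_semidef_form_zero[of X w] ge le tX
    by (metis antisym pos_semidef_def)
  then have "S *v w = P *v w" for w
    by (simp add: Xv)
  then show ?thesis by (simp add: matrix_eq)
qed

lemma matrix_sqrt:
  fixes M :: "real^'n^'n"
  assumes "pos_semidef M"
  shows pos_semidef_matrix_sqrt: "pos_semidef (matrix_sqrt M)"
    and matrix_sqrt_mult_self: "matrix_sqrt M ** matrix_sqrt M = M"
proof -
  have "\<exists>!S. pos_semidef S \<and> S ** S = M"
    using pos_semidef_sqrt_exists[OF assms] pos_semidef_sqrt_unique by metis
  from theI'[OF this] show "pos_semidef (matrix_sqrt M)" "matrix_sqrt M ** matrix_sqrt M = M"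
    by (simp_all add: matrix_sqrt_def)
qed

text \<open>On the orthogonal complement of its kernel \<open>L\<close> is injective, hence bounded
  below by some \<open>e\<close>. The component of \<open>x\<close> in that complement has the same
  image as \<open>x\<close> and is at least as long as the distance to the kernel. This turns
  dissipation into distance.\<close>

lemma matrix_norm_ge_infdist_ker:
  fixes L :: "real^'n^'m"
  obtains e where "e > 0" "\<And>x. e * infdist x (matrix_ker L) \<le> norm (L *v x)"
proof -
  let ?V = "matrix_ker L"
  let ?W = "{y. \<forall>x\<in>?V. orthogonal x y}"
  have V: "subspace ?V"
    by (auto simp: matrix_ker_def subspace_def matrix_vector_right_distrib matrix_vector_mult_scaleR)
  have W: "subspace ?W" by (rule subspace_orthogonal_to_vectors)
  have inj: "\<forall>x\<in>?W. L *v x = 0 \<longrightarrow> x = 0"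
    by (auto simp: matrix_ker_def orthogonal_def)
  obtain e where e: "e > 0" "\<And>x. x \<in> ?W \<Longrightarrow> e * norm x \<le> norm (L *v x)"
    using injective_imp_isometric[OF closed_subspace[OF W] W _ inj] by auto
  show ?thesis
  proof (rule that[OF e(1)])
    fix x
    obtain v w where vw: "v \<in> span ?V" "\<And>y. y \<in> span ?V \<Longrightarrow> orthogonal w y" "x = v + w"
      using orthogonal_subspace_decomp_exists[of ?V x] by metis
    have v: "v \<in> ?V" using vw(1) V by (metis span_eq_iff)
    have w: "w \<in> ?W" using vw(2) by (auto simp: span_base orthogonal_commute)
    have "infdist x ?V \<le> norm w"
      using infdist_le[OF v, of x] vw(3) by (simp add: dist_norm)
    then have "e * infdist x ?V \<le> e * norm w" using e by simp
    also have "\<dots> \<le> norm (L *v w)" using e(2)[OF w] .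
    also have "L *v w = L *v x"
      using v vw(3) by (simp add: matrix_ker_def matrix_vector_right_distrib)
    finally show "e * infdist x ?V \<le> norm (L *v x)" .
  qed
qed

subsection \<open>Absolutely continuous functions with bounded density\<close>

lemma absolutely_integrable_Icc_iff_Ioo:
  fixes f :: "real \<Rightarrow> 'a::euclidean_space"
  shows "f absolutely_integrable_on {a..b} \<longleftrightarrow> f absolutely_integrable_on {a<..<b}"
proof (rule absolutely_integrable_spike_set_eq)
  show "negligible {x \<in> {a..b} - {a<..<b}. f x \<noteq> 0}"
    by (rule negligible_subset[of "{a, b}"]) auto
  show "negligible {x \<in> {a<..<b} - {a..b}. f x \<noteq> 0}"
    by (rule negligible_subset[of "{}"]) auto
qed

lemma LINT_Ioo_eq_integral:
  fixes f :: "real \<Rightarrow> 'a::euclidean_space"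
  assumes "f absolutely_integrable_on {a..b}"
  shows "(LINT t:{a<..<b}|lebesgue. f t) = integral {a..b} f"
  using assms
  by (simp add: absolutely_integrable_Icc_iff_Ioo set_lebesgue_integral_eq_integral(2)
      integral_open_interval_real)

lemma absolutely_integrable_bilinear_continuous:
  fixes g :: "real \<Rightarrow> 'b::euclidean_space" and F :: "real \<Rightarrow> 'a::euclidean_space"
    and prod :: "'a \<Rightarrow> 'b \<Rightarrow> 'c::euclidean_space"
  assumes "bounded_bilinear prod" "continuous_on {a..b} F" "g absolutely_integrable_on {a..b}"
  shows "(\<lambda>t. prod (F t) (g t)) absolutely_integrable_on {a..b}"
proof (rule absolutely_integrable_bounded_measurable_product[where h = prod and f = F and g = g])
  show "bilinear prod" using assms(1) by (simp add: bilinear_conv_bounded_bilinear)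
  show "F \<in> borel_measurable (lebesgue_on {a..b})"
    using assms(2) by (intro continuous_imp_measurable_on_sets_lebesgue) auto
  show "bounded (F ` {a..b})"
    using assms(2) by (intro compact_imp_bounded compact_continuous_image) auto
qed (use assms(3) in auto)

lemma continuous_on_of_has_integral:
  fixes F :: "real \<Rightarrow> 'a::euclidean_space"
  assumes "\<And>t. t \<in> {0..T} \<Longrightarrow> (f has_integral (F t - F 0)) {0..t}"
  shows "continuous_on {0..T} F"
proof (cases "0 \<le> T")
  case True
  then have "f integrable_on {0..T}"
    using assms[of T] by (auto simp: integrable_on_def)
  then have "continuous_on {0..T} (\<lambda>t. F 0 + integral {0..t} f)"
    by (intro continuous_intros indefinite_integral_continuous_1)
  moreover have "F 0 + integral {0..t} f = F t" if "t \<in> {0..T}" for t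
    using integral_unique[OF assms[OF that]] by simp
  ultimately show ?thesis by (rule continuous_on_eq)
qed simp

text \<open>The difference quotients are bounded by a multiple of the step, so the derivative is
  zero everywhere. This stands in for differentiating integrals almost everywhere.\<close>

lemma constant_of_quadratic_increments:
  fixes D :: "real \<Rightarrow> 'a::real_normed_vector"
  assumes "\<And>s t. s \<in> {0..T} \<Longrightarrow> t \<in> {0..T} \<Longrightarrow> s \<le> t \<Longrightarrow> norm (D t - D s) \<le> C * (t - s)\<^sup>2"
    and "t \<in> {0..T}"
  shows "D t = D 0"
proof -
  have incr: "norm (D y - D x) \<le> \<bar>C\<bar> * \<bar>y - x\<bar> * \<bar>y - x\<bar>" if "x \<in> {0..T}" "y \<in> {0..T}" for x y
  proof -
    have "norm (D y - D x) \<le> C * (y - x)\<^sup>2"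
      using assms(1)[of x y] assms(1)[of y x] that
      by (cases "x \<le> y") (auto simp: norm_minus_commute power2_commute)
    also have "\<dots> \<le> \<bar>C\<bar> * (y - x)\<^sup>2" by (intro mult_right_mono) auto
    finally show ?thesis by (simp add: power2_eq_square abs_mult_self_eq mult.assoc flip: abs_mult)
  qed
  have "(D has_vector_derivative 0) (at x within {0..T})" if x: "x \<in> {0..T}" for x
    unfolding has_vector_derivative_def has_derivative_within_alt
  proof (intro conjI allI impI)
    fix e :: real assume e: "e > 0"
    \<comment> \<open>The added 1 covers the case \<open>C = 0\<close>.\<close>
    define d where "d = e / (\<bar>C\<bar> + 1)"
    have d: "d > 0" "\<bar>C\<bar> * d \<le> e"
      using e by (auto simp: d_def divide_simps)
    have "norm (D y - D x) \<le> e * \<bar>y - x\<bar>" if y: "y \<in> {0..T}" "\<bar>y - x\<bar> < d" for y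
    proof -
      have "norm (D y - D x) \<le> (\<bar>C\<bar> * \<bar>y - x\<bar>) * \<bar>y - x\<bar>" by (rule incr[OF x y(1)])
      also have "\<dots> \<le> (\<bar>C\<bar> * d) * \<bar>y - x\<bar>"
        using y(2) by (intro mult_right_mono mult_left_mono) auto
      also have "\<dots> \<le> e * \<bar>y - x\<bar>"
        using d by (intro mult_right_mono) auto
      finally show ?thesis .
    qed
    then show "\<exists>d>0. \<forall>y\<in>{0..T}. norm (y - x) < d \<longrightarrow>
        norm (D y - D x - (y - x) *\<^sub>R 0) \<le> e * norm (y - x)"
      using d by (intro exI[of _ d]) auto
  qed simp
  then obtain c where "\<And>x. x \<in> {0..T} \<Longrightarrow> D x = c"
    using has_vector_derivative_zero_constant[of "{0..T}" D] by auto
  then show ?thesis using assms(2) by auto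
qed

lemma has_integral_increment:
  fixes F :: "real \<Rightarrow> 'a::euclidean_space"
  assumes f: "\<And>t. t \<in> {0..T} \<Longrightarrow> (f has_integral (F t - F 0)) {0..t}"
    and st: "0 \<le> s" "s \<le> t" "t \<le> T"
  shows "(f has_integral (F t - F s)) {s..t}"
proof -
  have ft: "(f has_integral (F t - F 0)) {0..t}" and fs: "(f has_integral (F s - F 0)) {0..s}"
    using f st by auto
  then have "f integrable_on {0..t}" by (auto simp: integrable_on_def)
  then have i: "f integrable_on {s..t}"
    using st by (auto intro: integrable_subinterval_real)
  then have "(f has_integral ((F s - F 0) + integral {s..t} f)) {0..t}"
    using st by (intro has_integral_combine[OF _ _ fs integrable_integral]) auto
  then have "(F s - F 0) + integral {s..t} f = F t - F 0"
    using ft by (rule has_integral_unique)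
  then have "integral {s..t} f = F t - F s" by (simp add: algebra_simps)
  then show ?thesis using i by (metis integrable_integral)
qed

lemma norm_increment_le:
  fixes F :: "real \<Rightarrow> 'a::euclidean_space"
  assumes f: "\<And>t. t \<in> {0..T} \<Longrightarrow> (f has_integral (F t - F 0)) {0..t}"
    and fM: "\<And>t. t \<in> {0..T} \<Longrightarrow> norm (f t) \<le> M" and st: "0 \<le> s" "s \<le> t" "t \<le> T"
  shows "norm (F t - F s) \<le> M * (t - s)"
proof -
  have "0 \<le> M" using fM[of s] st by (smt (verit) atLeastAtMost_iff norm_ge_zero)
  then show ?thesis
    using has_integral_bound_real[OF _ _ has_integral_increment[OF f st], of M "{}"] fM st by auto
qed

text \<open>Bounded densities make \<open>F\<close> and \<open>G\<close> Lipschitz, so over a short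
  interval the increment of the product and the integral of the product-rule density differ only to
  second order in its length. Hence their difference \<open>D\<close> is constant.\<close>

lemma integration_by_parts_bounded_densities:
  fixes F f :: "real \<Rightarrow> 'a::euclidean_space" and G g :: "real \<Rightarrow> 'b::euclidean_space"
    and prod :: "'a \<Rightarrow> 'b \<Rightarrow> 'c::euclidean_space"
  assumes bb: "bounded_bilinear prod"
    and f: "\<And>t. t \<in> {0..T} \<Longrightarrow> (f has_integral (F t - F 0)) {0..t}"
    and g: "\<And>t. t \<in> {0..T} \<Longrightarrow> (g has_integral (G t - G 0)) {0..t}"
    and fM: "\<And>t. t \<in> {0..T} \<Longrightarrow> norm (f t) \<le> M"
    and gM: "\<And>t. t \<in> {0..T} \<Longrightarrow> norm (g t) \<le> M"
    and t: "t \<in> {0..T}"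
  shows "((\<lambda>s. prod (f s) (G s) + prod (F s) (g s)) has_integral
           (prod (F t) (G t) - prod (F 0) (G 0))) {0..t}"
proof -
  interpret bounded_bilinear prod by (rule bb)
  obtain K where K: "K > 0" "\<And>a b. norm (prod a b) \<le> norm a * norm b * K"
    using pos_bounded by auto
  have T: "0 \<le> T" using t by simp
  have M: "0 \<le> M" using fM[of 0] T by (smt (verit) atLeastAtMost_iff norm_ge_zero)
  have contF: "continuous_on {0..T} F" by (rule continuous_on_of_has_integral[OF f])
  have contG: "continuous_on {0..T} G" by (rule continuous_on_of_has_integral[OF g])
  have fa: "f absolutely_integrable_on {0..T}"
    using f[of T] T fM
    by (intro absolutely_integrable_integrable_bound[where g = "\<lambda>_. M"]) (auto simp: integrable_on_def)
  have ga: "g absolutely_integrable_on {0..T}"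
    using g[of T] T gM
    by (intro absolutely_integrable_integrable_bound[where g = "\<lambda>_. M"]) (auto simp: integrable_on_def)
  define h where "h = (\<lambda>s. prod (f s) (G s) + prod (F s) (g s))"
  have "h absolutely_integrable_on {0..T}"
    unfolding h_def
    using absolutely_integrable_bilinear_continuous[OF bb contF ga]
      absolutely_integrable_bilinear_continuous[OF flip contG fa] by (rule set_integral_add(1)[rotated])
  then have h: "h integrable_on {0..T}" by (rule set_lebesgue_integral_eq_integral(1))
  define D where "D = (\<lambda>t. prod (F t) (G t) - integral {0..t} h)"
  have "norm (D t - D s) \<le> (2 * K * M * M) * (t - s)\<^sup>2"
    if s: "s \<in> {0..T}" and t: "t \<in> {0..T}" and st: "s \<le> t" for s t
  proof -
    \<comment> \<open>Freezing \<open>G\<close> at \<open>t\<close> and \<open>F\<close> at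
      \<open>s\<close> gives the density \<open>prod (f r) (G t) + prod (F s) (g r)\<close>, whose
      integral is exactly the increment of the product. \<open>k\<close> is its deviation from
      \<open>h\<close>; each term pairs a bounded density with an increment of order
      \<open>t - s\<close>.\<close>
    define k where "k = (\<lambda>r. prod (f r) (G t - G r) + prod (F s - F r) (g r))"
    have hst: "(h has_integral (integral {0..t} h - integral {0..s} h)) {s..t}"
    proof (rule has_integral_increment[where F = "\<lambda>t. integral {0..t} h"])
      show "(h has_integral (integral {0..r} h - integral {0..0} h)) {0..r}" if "r \<in> {0..T}" for r
        using integrable_integral[OF integrable_subinterval_real[OF h, of 0 r]] that by simp
    qed (use s t st in auto)
    have "((\<lambda>r. prod (f r) (G t)) has_integral prod (F t - F s) (G t)) {s..t}"
      using has_integral_linear[OF has_integral_increment[of T f F s t] bounded_linear_left[of "G t"]]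
        f s t st by (simp add: o_def)
    moreover have "((\<lambda>r. prod (F s) (g r)) has_integral prod (F s) (G t - G s)) {s..t}"
      using has_integral_linear[OF has_integral_increment[of T g G s t] bounded_linear_right[of "F s"]]
        g s t st by (simp add: o_def)
    ultimately have "((\<lambda>r. prod (f r) (G t) + prod (F s) (g r) - h r) has_integral
        (prod (F t - F s) (G t) + prod (F s) (G t - G s) - (integral {0..t} h - integral {0..s} h))) {s..t}"
      by (intro has_integral_diff has_integral_add hst)
    also have "(\<lambda>r. prod (f r) (G t) + prod (F s) (g r) - h r) = k"
      by (simp add: k_def h_def diff_left diff_right algebra_simps)
    also have "prod (F t - F s) (G t) + prod (F s) (G t - G s) - (integral {0..t} h - integral {0..s} h)
        = D t - D s"
      by (simp add: D_def diff_left diff_right algebra_simps)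
    finally have kD: "(k has_integral (D t - D s)) {s..t}" .
    have kb: "norm (k r) \<le> 2 * K * M * M * (t - s)" if r: "r \<in> {s..t}" for r
    proof -
      have "norm (G t - G r) \<le> M * (t - s)"
        by (rule order_trans[OF norm_increment_le[OF g gM]]) (use r s t M in \<open>auto intro!: mult_left_mono\<close>)
      then have "norm (prod (f r) (G t - G r)) \<le> M * (M * (t - s)) * K"
        using r s t K M fM[of r]
        by (intro order_trans[OF K(2)] mult_right_mono mult_mono) auto
      moreover have "norm (F s - F r) \<le> M * (t - s)"
        unfolding norm_minus_commute[of "F s"]
        by (rule order_trans[OF norm_increment_le[OF f fM]]) (use r s t M in \<open>auto intro!: mult_left_mono\<close>)
      then have "norm (prod (F s - F r) (g r)) \<le> (M * (t - s)) * M * K"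
        using r s t K M gM[of r]
        by (intro order_trans[OF K(2)] mult_right_mono mult_mono) auto
      ultimately show ?thesis
        unfolding k_def using norm_triangle_ineq[of "prod (f r) (G t - G r)" "prod (F s - F r) (g r)"]
        by (simp add: algebra_simps)
    qed
    have "norm (D t - D s) \<le> (2 * K * M * M * (t - s)) * measure lborel {s..t}"
      using kb K M st by (intro has_integral_bound_real[OF _ _ kD, of _ "{}"]) auto
    then show ?thesis using st by (simp add: power2_eq_square mult.assoc)
  qed
  then have "D t = D 0" by (rule constant_of_quadratic_increments[OF _ t])
  then have "integral {0..t} h = prod (F t) (G t) - prod (F 0) (G 0)"
    by (simp add: D_def algebra_simps)
  moreover have "h integrable_on {0..t}"
    using h t by (auto intro: integrable_subinterval_real)
  ultimately show ?thesis
    unfolding h_def[symmetric] by (metis integrable_integral)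
qed

text \<open>The test function is an antiderivative of \<open>\<theta> (p - c)\<close>, where \<open>p\<close> is a component of \<open>g\<close>, \<open>\<theta>\<close> a bump
  on \<open>[a, b]\<close> and \<open>c\<close> the \<open>\<theta>\<close>-mean of \<open>p\<close>; orthogonality then says that the \<open>\<theta>\<close>-variance of \<open>p\<close> vanishes.\<close>

lemma du_bois_reymond_interior:
  fixes g :: "real \<Rightarrow> 'a::euclidean_space"
  assumes cont: "continuous_on {0..T} g"
    and orth: "\<And>\<phi>. \<phi> \<in> test_functions T \<Longrightarrow> integral {0..T} (\<lambda>t. deriv \<phi> t *\<^sub>R g t) = 0"
    and ab: "0 < a" "a < b" "b < T" and st: "s \<in> {a<..<b}" "t \<in> {a<..<b}"
  shows "g s = g t"
proof (rule euclidean_eqI)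
  fix i :: 'a assume i: "i \<in> Basis"
  \<comment> \<open>Clamping the argument to \<open>[a, b]\<close> makes \<open>p\<close> continuous
    on the whole line, so that a global antiderivative exists and serves as test function.\<close>
  define p where "p = (\<lambda>t. g (max a (min b t)) \<bullet> i)"
  define \<theta> where "\<theta> = (\<lambda>t. max 0 ((t - a) * (b - t)))"
  have cp: "continuous_on UNIV p"
    unfolding p_def
    using ab by (intro continuous_intros continuous_on_compose2[OF cont]) auto
  have c\<theta>: "continuous_on UNIV \<theta>"
    unfolding \<theta>_def by (intro continuous_intros)
  have \<theta>0: "\<theta> t = 0" if "t \<notin> {a<..<b}" for t
  proof -
    have "(t - a) * (b - t) \<le> 0"
      using that ab by (cases "t \<le> a") (auto intro: mult_nonpos_nonneg mult_nonneg_nonpos)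
    then show ?thesis by (simp add: \<theta>_def)
  qed
  have \<theta>pos: "\<theta> t > 0" if "t \<in> {a<..<b}" for t
    using that by (simp add: \<theta>_def)
  have \<theta>ge: "\<theta> t \<ge> 0" for t by (simp add: \<theta>_def)
  have int: "k integrable_on {a..b}" if "continuous_on UNIV k" for k :: "real \<Rightarrow> real"
    using that by (intro integrable_continuous_real) (auto intro: continuous_on_subset)
  have "integral {a..b} \<theta> \<noteq> 0"
    using integral_eq_0_iff[of a b \<theta>] c\<theta> \<theta>ge \<theta>pos[of s] st ab
    by (metis UNIV_I atLeastAtMost_iff continuous_on_subset greaterThanLessThan_iff less_le subsetI)
  define c where "c = integral {a..b} (\<lambda>t. \<theta> t * p t) / integral {a..b} \<theta>"
  define h where "h = (\<lambda>t. \<theta> t * (p t - c))"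
  have ch: "continuous_on UNIV h"
    unfolding h_def by (intro continuous_intros cp c\<theta>)
  have h0: "h t = 0" if "t \<notin> {a<..<b}" for t using \<theta>0[OF that] by (simp add: h_def)
  have "integral {a..b} h = integral {a..b} (\<lambda>t. \<theta> t * p t - c * \<theta> t)"
    by (simp add: h_def algebra_simps)
  also have "\<dots> = integral {a..b} (\<lambda>t. \<theta> t * p t) - c * integral {a..b} \<theta>"
    using c\<theta> cp by (subst Henstock_Kurzweil_Integration.integral_diff) (auto intro!: int continuous_intros)
  also have "\<dots> = 0"
    using \<open>integral {a..b} \<theta> \<noteq> 0\<close> by (simp add: c_def)
  finally have hint: "integral {a..b} h = 0" .
  obtain H where H: "\<And>x. (H has_vector_derivative h x) (at x)"
    using einterval_antiderivative[of "-\<infinity>" "\<infinity>" h] ch by (auto simp: continuous_on_eq_continuous_at)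
  define \<phi> where "\<phi> = (\<lambda>t. H t - H a)"
  have \<phi>': "(\<phi> has_vector_derivative h x) (at x)" for x
    unfolding \<phi>_def using H[of x] by (auto intro!: derivative_eq_intros)
  have ftc: "(h has_integral (\<phi> y - \<phi> x)) {x..y}" if "x \<le> y" for x y
    using that \<phi>' by (intro fundamental_theorem_of_calculus) (auto intro: has_vector_derivative_at_within)
  have "\<phi> a = 0" by (simp add: \<phi>_def)
  have \<phi>0: "\<phi> t = 0" if t: "t \<notin> {a..b}" for t
  proof (cases "t < a")
    case True
    have "(h has_integral 0) {t..a}"
      using h0 by (intro has_integral_is_0) auto
    then show ?thesis
      using ftc[of t a] True \<open>\<phi> a = 0\<close> by (metis diff_0 has_integral_unique less_imp_le minus_equation_iff minus_zero)
  next
    case False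
    then have bt: "b < t" using t by auto
    have "(h has_integral 0) {b..t}"
      using h0 by (intro has_integral_is_0) auto
    then have "\<phi> t = \<phi> b"
      using ftc[of b t] bt by (metis eq_iff_diff_eq_0 has_integral_unique less_imp_le)
    moreover have "\<phi> b = 0"
      using ftc[of a b] ab hint \<open>\<phi> a = 0\<close> by (simp add: has_integral_iff)
    ultimately show ?thesis by simp
  qed
  have d\<phi>: "deriv \<phi> = h"
    using \<phi>' by (intro ext DERIV_imp_deriv) (simp add: has_real_derivative_iff_has_vector_derivative)
  have "\<phi> \<in> test_functions T"
    unfolding test_functions_def C1_differentiable_on_def using \<phi>' ch \<phi>0 ab by blast
  from orth[OF this] have "integral {0..T} (\<lambda>t. h t *\<^sub>R g t) = 0" by (simp add: d\<phi>)
  moreover have "(\<lambda>t. h t *\<^sub>R g t) integrable_on {0..T}"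
    using cont ch by (intro integrable_continuous_real continuous_intros) (auto intro: continuous_on_subset)
  ultimately have "((\<lambda>t. h t *\<^sub>R g t) has_integral 0) {0..T}" by (simp add: has_integral_iff)
  from has_integral_linear[OF this bounded_linear_inner_left[of i]]
  have "((\<lambda>t. h t * (g t \<bullet> i)) has_integral 0) {0..T}" by (simp add: o_def)
  then have "((\<lambda>t. h t * p t) has_integral 0) {0..T}"
    by (rule has_integral_eq[rotated]) (use h0 in \<open>force simp: p_def max_def min_def\<close>)
  then have "((\<lambda>t. if t \<in> {a..b} then h t * p t else 0) has_integral 0) {0..T}"
    by (rule has_integral_eq[rotated]) (use h0 in auto)
  then have "((\<lambda>t. h t * p t) has_integral 0) {a..b}"
    using has_integral_restrict[of "{a..b}" "{0..T}" "\<lambda>t. h t * p t"] ab by auto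
  \<comment> \<open>As \<open>h\<close> has mean zero, \<open>c * h\<close> may be subtracted
    freely; this completes the square \<open>(p t - c)\<^sup>2\<close>.\<close>
  moreover have "((\<lambda>t. c * h t) has_integral c * 0) {a..b}"
    using int[OF ch] hint by (intro has_integral_mult_right) (simp add: has_integral_iff)
  ultimately have "((\<lambda>t. h t * p t - c * h t) has_integral 0 - c * 0) {a..b}"
    by (rule has_integral_diff)
  moreover have "(\<lambda>t. h t * p t - c * h t) = (\<lambda>t. \<theta> t * (p t - c)\<^sup>2)"
    by (simp add: h_def power2_eq_square algebra_simps)
  ultimately have "integral {a..b} (\<lambda>t. \<theta> t * (p t - c)\<^sup>2) = 0"
    by (simp add: integral_unique)
  moreover have "continuous_on {a..b} (\<lambda>t. \<theta> t * (p t - c)\<^sup>2)"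
    using cp c\<theta> by (intro continuous_intros) (auto intro: continuous_on_subset)
  ultimately have "\<forall>t\<in>{a..b}. \<theta> t * (p t - c)\<^sup>2 = 0"
    using integral_eq_0_iff[of a b "\<lambda>t. \<theta> t * (p t - c)\<^sup>2"] \<theta>ge ab by auto
  then have pc: "p t = c" if "t \<in> {a<..<b}" for t
    using \<theta>pos[OF that] that by force
  show "g s \<bullet> i = g t \<bullet> i"
    using pc[OF st(1)] pc[OF st(2)] st by (simp add: p_def)
qed

text \<open>Every interior time shares with \<open>T / 2\<close> an open interval whose closure lies
  in \<open>(0, T)\<close>; continuity then carries the constant to the endpoints.\<close>

lemma du_bois_reymond:
  fixes g :: "real \<Rightarrow> 'a::euclidean_space"
  assumes cont: "continuous_on {0..T} g"
    and orth: "\<And>\<phi>. \<phi> \<in> test_functions T \<Longrightarrow> integral {0..T} (\<lambda>t. deriv \<phi> t *\<^sub>R g t) = 0"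
    and T: "0 < T" and t: "t \<in> {0..T}"
  shows "g t = g 0"
proof -
  have mid: "g s = g (T / 2)" if s: "s \<in> {0<..<T}" for s
  proof (rule du_bois_reymond_interior[OF cont orth])
    show "0 < min s (T / 2) / 2" "max ((s + T) / 2) (3 * T / 4) < T" using s T by auto
    show "s \<in> {min s (T / 2) / 2<..<max ((s + T) / 2) (3 * T / 4)}"
      "T / 2 \<in> {min s (T / 2) / 2<..<max ((s + T) / 2) (3 * T / 4)}"
      "min s (T / 2) / 2 < max ((s + T) / 2) (3 * T / 4)"
      using s T by (auto simp: min_def max_def)
  qed
  have "g s = g (T / 2)" if "s \<in> {0..T}" for s
    by (rule continuous_constant_on_closure[of "{0<..<T}", OF _ mid]) (use cont T that in auto)
  from this[of t] this[of 0] show ?thesis using t T by simp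
qed

subsection \<open>Trajectories in integral form\<close>

text \<open>Requiring \<open>u t \<in> U\<close> for all times, not only in \<open>(0, T)\<close>, makes
  concatenation painless and costs nothing, since \<open>0 \<in> U\<close> in all applications.\<close>

definition steers ::
  "real^'n^'n \<Rightarrow> real^'m^'n \<Rightarrow> (real^'m) set \<Rightarrow> real \<Rightarrow> (real \<Rightarrow> real^'m) \<Rightarrow> (real \<Rightarrow> real^'n) \<Rightarrow> bool" where
  "steers A B U T u x \<longleftrightarrow> (\<forall>t. u t \<in> U) \<and> u integrable_on {0..T} \<and>
     (\<forall>t\<in>{0..T}. ((\<lambda>s. A *v x s + B *v u s) has_integral (x t - x 0)) {0..t})"

lemma steers_continuous: "steers A B U T u x \<Longrightarrow> continuous_on {0..T} x"
  unfolding steers_def by (rule continuous_on_of_has_integral) auto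

text \<open>Supplies the uniform bound on densities that the product rule requires.\<close>

lemma velocity_bounded:
  fixes A :: "real^'n^'n" and B :: "real^'m^'n" and x :: "real \<Rightarrow> real^'n" and u :: "real \<Rightarrow> real^'m"
  assumes "bounded U" "\<And>t. u t \<in> U" "continuous_on {0..T} x"
  obtains M where "\<And>t. t \<in> {0..T} \<Longrightarrow> norm (A *v x t + B *v u t) \<le> M"
proof -
  have "compact (x ` {0..T})"
    using assms(3) compact_Icc by (rule compact_continuous_image)
  then have "bounded ((*v) A ` (x ` {0..T}))"
    by (simp add: bounded_linear_image compact_imp_bounded)
  moreover have "bounded ((*v) B ` U)"
    using assms(1) by (simp add: bounded_linear_image)
  ultimately obtain a b where a: "\<And>y. y \<in> (*v) A ` x ` {0..T} \<Longrightarrow> norm y \<le> a"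
      and b: "\<And>y. y \<in> (*v) B ` U \<Longrightarrow> norm y \<le> b"
    unfolding bounded_iff by metis
  show ?thesis
  proof (rule that)
    show "norm (A *v x t + B *v u t) \<le> a + b" if "t \<in> {0..T}" for t
      using assms(2) that by (intro norm_triangle_mono a b) auto
  qed
qed

lemma steers_velocity_bounded:
  assumes "steers A B U T u x" "bounded U"
  obtains M where "\<And>t. t \<in> {0..T} \<Longrightarrow> norm (A *v x t + B *v u t) \<le> M"
proof (rule velocity_bounded[of U u T x A B])
  show "u t \<in> U" for t using assms(1) by (simp add: steers_def)
qed (use assms steers_continuous that in blast)+

lemma absolutely_integrable_of_bounded_range:
  fixes u :: "real \<Rightarrow> 'a::euclidean_space"
  assumes "u integrable_on {a..b}" "bounded U" "\<And>t. u t \<in> U"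
  shows "u absolutely_integrable_on {a..b}"
proof -
  obtain M where "\<And>v. v \<in> U \<Longrightarrow> norm v \<le> M"
    using assms(2) by (auto simp: bounded_iff)
  then show ?thesis
    using assms by (intro absolutely_integrable_integrable_bound[where g = "\<lambda>_. M"]) auto
qed

lemma absolutely_integrable_matrix_vector_mult:
  fixes M :: "real^'n^'m" and f :: "real \<Rightarrow> real^'n"
  assumes "f absolutely_integrable_on S"
  shows "(\<lambda>t. M *v f t) absolutely_integrable_on S"
  using absolutely_integrable_linear[OF assms, of "(*v) M"] by (simp add: o_def)

section \<open>Weak and integral form of the state equation\<close>

lemma test_function_properties:
  assumes "\<phi> \<in> test_functions T"
  shows "continuous_on UNIV (deriv \<phi>)" "continuous_on UNIV \<phi>" "\<phi> 0 = 0" "\<phi> T = 0"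
    and "\<And>t. t \<in> {0..T} \<Longrightarrow> (deriv \<phi> has_integral (\<phi> t - \<phi> 0)) {0..t}"
proof -
  from assms obtain D a b where D: "\<And>t. (\<phi> has_vector_derivative D t) (at t)" "continuous_on UNIV D"
    and ab: "0 < a" "b < T" "\<And>t. t \<notin> {a..b} \<Longrightarrow> \<phi> t = 0"
    unfolding test_functions_def C1_differentiable_on_def by auto
  have d: "deriv \<phi> = D"
    using D(1) by (intro ext DERIV_imp_deriv) (simp add: has_real_derivative_iff_has_vector_derivative)
  show "continuous_on UNIV (deriv \<phi>)" using d D(2) by simp
  show "continuous_on UNIV \<phi>"
    using D(1) by (meson continuous_at_imp_continuous_on has_vector_derivative_continuous)
  show "\<phi> 0 = 0" "\<phi> T = 0" using ab by auto
  show "(deriv \<phi> has_integral (\<phi> t - \<phi> 0)) {0..t}" if "t \<in> {0..T}" for t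
    unfolding d using that D(1)
    by (intro fundamental_theorem_of_calculus) (auto intro: has_vector_derivative_at_within)
qed

lemma integration_by_parts_test_function:
  fixes f :: "real \<Rightarrow> 'a::euclidean_space"
  assumes \<phi>: "\<phi> \<in> test_functions T" and T: "0 \<le> T"
    and f: "\<And>t. t \<in> {0..T} \<Longrightarrow> (f has_integral (F t - F 0)) {0..t}"
    and fM: "\<And>t. t \<in> {0..T} \<Longrightarrow> norm (f t) \<le> M"
  shows "integral {0..T} (\<lambda>t. deriv \<phi> t *\<^sub>R F t) = - integral {0..T} (\<lambda>t. \<phi> t *\<^sub>R f t)"
    and "(\<lambda>t. \<phi> t *\<^sub>R f t) absolutely_integrable_on {0..T}"
    and "(\<lambda>t. deriv \<phi> t *\<^sub>R F t) absolutely_integrable_on {0..T}"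
proof -
  note tf = test_function_properties[OF \<phi>]
  have cF: "continuous_on {0..T} F" by (rule continuous_on_of_has_integral[OF f])
  have "f integrable_on {0..T}" using f[of T] T by (auto simp: integrable_on_def)
  then have fa: "f absolutely_integrable_on {0..T}"
    using fM by (intro absolutely_integrable_integrable_bound[where g = "\<lambda>_. M"]) auto
  show 1: "(\<lambda>t. \<phi> t *\<^sub>R f t) absolutely_integrable_on {0..T}"
    using continuous_on_subset[OF tf(2) subset_UNIV] fa
    by (rule absolutely_integrable_bilinear_continuous[OF bounded_bilinear_scaleR])
  show 2: "(\<lambda>t. deriv \<phi> t *\<^sub>R F t) absolutely_integrable_on {0..T}"
    by (intro absolutely_integrable_continuous_real continuous_on_scaleR cF
        continuous_on_subset[OF tf(1) subset_UNIV])
  have "bounded (deriv \<phi> ` {0..T})"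
    by (intro compact_imp_bounded compact_continuous_image continuous_on_subset[OF tf(1) subset_UNIV] compact_Icc)
  then obtain N where N: "\<And>t. t \<in> {0..T} \<Longrightarrow> norm (deriv \<phi> t) \<le> N"
    unfolding bounded_iff by blast
  have "((\<lambda>s. deriv \<phi> s *\<^sub>R F s + \<phi> s *\<^sub>R f s) has_integral (\<phi> T *\<^sub>R F T - \<phi> 0 *\<^sub>R F 0)) {0..T}"
    by (rule integration_by_parts_bounded_densities[OF bounded_bilinear_scaleR tf(5) f, where M = "max M N" and T = T])
      (use T fM N in \<open>force simp: le_max_iff_disj\<close>)+
  then have "integral {0..T} (\<lambda>s. deriv \<phi> s *\<^sub>R F s + \<phi> s *\<^sub>R f s) = 0"
    by (simp add: tf integral_unique)
  then show "integral {0..T} (\<lambda>t. deriv \<phi> t *\<^sub>R F t) = - integral {0..T} (\<lambda>t. \<phi> t *\<^sub>R f t)"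
    using 1 2
    by (simp add: Henstock_Kurzweil_Integration.integral_add set_lebesgue_integral_eq_integral(1) eq_neg_iff_add_eq_0)
qed

lemma steers_imp_state_trajectory:
  assumes st: "steers A B U T u x" and U: "bounded U" and T: "0 \<le> T"
  shows "u \<in> L1_controls T U" and "state_trajectory A B T (x 0) u x"
proof -
  have ua: "u absolutely_integrable_on {0..T}"
    using st U unfolding steers_def by (intro absolutely_integrable_of_bounded_range[of _ _ _ U]) auto
  then show "u \<in> L1_controls T U"
    using st unfolding L1_controls_def steers_def by (simp add: absolutely_integrable_Icc_iff_Ioo)
  have cx: "continuous_on {0..T} x" by (rule steers_continuous[OF st])
  then have xa: "x absolutely_integrable_on {0..T}"
    by (rule absolutely_integrable_continuous_real)
  define f where "f = (\<lambda>s. A *v x s + B *v u s)"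
  have fa: "f absolutely_integrable_on {0..T}"
    unfolding f_def
    by (intro set_integral_add(1) absolutely_integrable_matrix_vector_mult xa ua)
  obtain M where M: "\<And>t. t \<in> {0..T} \<Longrightarrow> norm (f t) \<le> M"
    using steers_velocity_bounded[OF st U] unfolding f_def by metis
  have f: "\<And>t. t \<in> {0..T} \<Longrightarrow> (f has_integral (x t - x 0)) {0..t}"
    using st by (simp add: steers_def f_def)
  have "weak_derivative T x f"
    unfolding weak_derivative_def
  proof (intro conjI ballI)
    show "set_integrable lebesgue {0<..<T} x" "set_integrable lebesgue {0<..<T} f"
      using xa fa by (simp_all add: absolutely_integrable_Icc_iff_Ioo)
    fix \<phi> assume "\<phi> \<in> test_functions T"
    from integration_by_parts_test_function[OF this T f M]
    show "(LINT t:{0<..<T}|lebesgue. deriv \<phi> t *\<^sub>R x t) = - (LINT t:{0<..<T}|lebesgue. \<phi> t *\<^sub>R f t)"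
      by (simp add: LINT_Ioo_eq_integral)
  qed
  then show "state_trajectory A B T (x 0) u x"
    unfolding state_trajectory_def using cx by (auto simp: f_def)
qed

text \<open>If \<open>F\<close> is a primitive of the right-hand side, then \<open>x - F\<close> has
  zero weak derivative and is constant by du Bois-Reymond. The control is reset to 0 outside
  \<open>(0, T)\<close>, where \<open>L1_controls\<close> says nothing about its values.\<close>

lemma state_trajectory_imp_steers:
  assumes u: "u \<in> L1_controls T U" and tr: "state_trajectory A B T x0 u x"
    and U: "bounded U" "0 \<in> U" and T: "0 \<le> T"
  shows "steers A B U T (\<lambda>t. if t \<in> {0<..<T} then u t else 0) x"
proof -
  define v where "v = (\<lambda>t. if t \<in> {0<..<T} then u t else 0)"
  define f where "f = (\<lambda>s. A *v x s + B *v v s)"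
  have vU: "v t \<in> U" for t using u U by (auto simp: v_def L1_controls_def)
  have "u absolutely_integrable_on {0..T}"
    using u by (simp add: L1_controls_def absolutely_integrable_Icc_iff_Ioo)
  then have va: "v absolutely_integrable_on {0..T}"
    by (rule absolutely_integrable_spike[of _ _ "{0, T}"]) (auto simp: v_def)
  have cx: "continuous_on {0..T} x"
    using tr by (simp add: state_trajectory_def)
  then have xa: "x absolutely_integrable_on {0..T}"
    by (rule absolutely_integrable_continuous_real)
  have fa: "f absolutely_integrable_on {0..T}"
    unfolding f_def
    by (intro set_integral_add(1) absolutely_integrable_matrix_vector_mult xa va)
  then have fi: "f integrable_on {0..T}" by (rule set_lebesgue_integral_eq_integral(1))
  define F where "F = (\<lambda>t. integral {0..t} f)"
  have F: "(f has_integral (F t - F 0)) {0..t}" if "t \<in> {0..T}" for t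
    using integrable_integral[OF integrable_subinterval_real[OF fi, of 0 t]] that by (simp add: F_def)
  obtain M where M: "\<And>t. t \<in> {0..T} \<Longrightarrow> norm (f t) \<le> M"
    using velocity_bounded[of U v T x A B, OF U(1) vU cx] unfolding f_def by metis
  have cF: "continuous_on {0..T} F" by (rule continuous_on_of_has_integral[OF F])
  obtain x' where x': "weak_derivative T x x'"
    and ae: "AE t in lebesgue. t \<in> {0<..<T} \<longrightarrow> x' t = A *v x t + B *v u t"
    using tr by (auto simp: state_trajectory_def)
  obtain N where N: "N \<in> null_sets lebesgue"
    "\<And>t. t \<in> {0<..<T} \<Longrightarrow> t \<notin> N \<Longrightarrow> x' t = A *v x t + B *v u t"
    using ae unfolding eventually_ae_filter by auto
  \<comment> \<open>The endpoints join the exceptional set because the weak equation is given only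
    on the open interval.\<close>
  have "negligible (N \<union> {0, T})"
    using N(1) by (simp add: negligible_iff_null_sets)
  have xF: "x t - F t = x 0 - F 0" if t: "t \<in> {0..T}" for t
  proof (cases "T = 0")
    \<comment> \<open>Reachability from the origin allows a zero horizon, for which du Bois-Reymond
      has no interior to work on.\<close>
    case True
    then show ?thesis using t by simp
  next
    case False
    with T have T': "0 < T" by simp
    show ?thesis
    proof (rule du_bois_reymond[of T "\<lambda>t. x t - F t", OF _ _ T' t])
      show "continuous_on {0..T} (\<lambda>t. x t - F t)" by (intro continuous_intros cx cF)
      fix \<phi> assume \<phi>: "\<phi> \<in> test_functions T"
      note ibp = integration_by_parts_test_function[OF \<phi> T F M]
      note tf = test_function_properties[OF \<phi>]
      have p1: "(\<lambda>t. deriv \<phi> t *\<^sub>R x t) absolutely_integrable_on {0..T}"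
        by (intro absolutely_integrable_continuous_real continuous_on_scaleR cx
            continuous_on_subset[OF tf(1) subset_UNIV])
      have "x' absolutely_integrable_on {0..T}"
        using x' by (simp add: weak_derivative_def absolutely_integrable_Icc_iff_Ioo)
      then have p2: "(\<lambda>t. \<phi> t *\<^sub>R x' t) absolutely_integrable_on {0..T}"
        by (rule absolutely_integrable_bilinear_continuous[OF bounded_bilinear_scaleR
              continuous_on_subset[OF tf(2) subset_UNIV]])
      have "integral {0..T} (\<lambda>t. deriv \<phi> t *\<^sub>R x t) = - integral {0..T} (\<lambda>t. \<phi> t *\<^sub>R x' t)"
        using x' \<phi> by (simp add: weak_derivative_def flip: LINT_Ioo_eq_integral[OF p1] LINT_Ioo_eq_integral[OF p2])
      also have "integral {0..T} (\<lambda>t. \<phi> t *\<^sub>R x' t) = integral {0..T} (\<lambda>t. \<phi> t *\<^sub>R f t)"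
        by (rule integral_spike[OF \<open>negligible (N \<union> {0, T})\<close>]) (use N(2) in \<open>auto simp: f_def v_def\<close>)
      finally show "integral {0..T} (\<lambda>t. deriv \<phi> t *\<^sub>R (x t - F t)) = 0"
        using ibp p1
        by (simp add: scaleR_diff_right Henstock_Kurzweil_Integration.integral_diff set_lebesgue_integral_eq_integral(1))
    qed
  qed
  have "(f has_integral (x t - x 0)) {0..t}" if t: "t \<in> {0..T}" for t
  proof -
    have "F t - F 0 = x t - x 0" using xF[OF t] by (simp add: algebra_simps)
    then show ?thesis using F[OF t] by simp
  qed
  then show ?thesis
    unfolding steers_def v_def[symmetric] using vU va
    by (auto simp: f_def intro: set_lebesgue_integral_eq_integral(1))
qed

text \<open>The product rule for the pair \<open>x\<close>, \<open>x\<close> under the form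
  \<open>a \<bullet> (Q *v b)\<close>; symmetry of \<open>Q\<close> merges its two terms, which
  accounts for the factor \<open>1 / 2\<close>.\<close>

lemma steers_energy_balance:
  fixes Q :: "real^'n^'n"
  assumes st: "steers A B U T u x" and U: "bounded U" and T: "0 \<le> T" and Q: "transpose Q = Q"
  shows "((\<lambda>t. (Q *v x t) \<bullet> (A *v x t + B *v u t)) has_integral
           ((x T \<bullet> (Q *v x T)) / 2 - (x 0 \<bullet> (Q *v x 0)) / 2)) {0..T}"
proof -
  define f where "f = (\<lambda>s. A *v x s + B *v u s)"
  obtain M where M: "\<And>t. t \<in> {0..T} \<Longrightarrow> norm (f t) \<le> M"
    using steers_velocity_bounded[OF st U] unfolding f_def by metis
  have f: "\<And>t. t \<in> {0..T} \<Longrightarrow> (f has_integral (x t - x 0)) {0..t}"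
    using st by (simp add: steers_def f_def)
  have bb: "bounded_bilinear (\<lambda>a b. a \<bullet> (Q *v b))"
    by (rule bounded_bilinear.comp[OF bounded_bilinear_inner bounded_linear_ident]) simp
  have "((\<lambda>s. f s \<bullet> (Q *v x s) + x s \<bullet> (Q *v f s)) has_integral (x T \<bullet> (Q *v x T) - x 0 \<bullet> (Q *v x 0))) {0..T}"
    by (rule integration_by_parts_bounded_densities[OF bb f f M M]) (use T in auto)
  also have "(\<lambda>s. f s \<bullet> (Q *v x s) + x s \<bullet> (Q *v f s)) = (\<lambda>s. 2 * ((Q *v x s) \<bullet> f s))"
    by (simp add: inner_commute[of "f _" "Q *v x _"] inner_matrix_vector_mult[of "x _" Q "f _"] Q)
  finally have "((\<lambda>s. 2 * ((Q *v x s) \<bullet> f s)) has_integral (x T \<bullet> (Q *v x T) - x 0 \<bullet> (Q *v x 0))) {0..T}" .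
  from has_integral_mult_right[OF this, of "1 / 2"] show ?thesis
    by (simp add: f_def diff_divide_distrib)
qed

section \<open>Enlarging the control set, resting and gluing trajectories\<close>

lemma steers_mono: "steers A B U T u x \<Longrightarrow> U \<subseteq> U' \<Longrightarrow> steers A B U' T u x"
  unfolding steers_def by blast

lemma steers_rest: "0 \<in> U \<Longrightarrow> steers A B U T (\<lambda>_. 0) (\<lambda>_. 0)"
  unfolding steers_def by (simp add: integrable_0)

lemma steers_concat:
  assumes s1: "steers A B U T1 u1 x1" and s2: "steers A B U T2 u2 x2"
    and join: "x2 0 = x1 T1" and T: "0 \<le> T1" "0 \<le> T2"
  shows "steers A B U (T1 + T2) (\<lambda>t. if t < T1 then u1 t else u2 (t - T1))
           (\<lambda>t. if t < T1 then x1 t else x2 (t - T1))"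
proof -
  let ?u = "\<lambda>t. if t < T1 then u1 t else u2 (t - T1)"
  let ?x = "\<lambda>t. if t < T1 then x1 t else x2 (t - T1)"
  let ?f = "\<lambda>s. A *v ?x s + B *v ?u s"
  have x0: "?x 0 = x1 0" using join T by auto
  \<comment> \<open>At \<open>T1\<close> the glued functions already take the values of the second
    piece, so the first density is altered in this one point.\<close>
  have left: "(?f has_integral (x1 t - x1 0)) {0..t}" if "t \<in> {0..T1}" for t
    by (rule has_integral_spike_finite[of "{T1}" _ _ "\<lambda>s. A *v x1 s + B *v u1 s"])
      (use s1 that in \<open>auto simp: steers_def\<close>)
  have right: "(?f has_integral (x2 (t - T1) - x2 0)) {T1..t}" if t: "t \<in> {T1..T1 + T2}" for t
  proof -
    have "((\<lambda>s. A *v x2 s + B *v u2 s) has_integral (x2 (t - T1) - x2 0)) {0..t - T1}"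
      using s2 t by (auto simp: steers_def)
    then have "((\<lambda>s. A *v x2 (s - T1) + B *v u2 (s - T1)) has_integral (x2 (t - T1) - x2 0)) {T1..t}"
      using has_integral_shift_real_ivl[of "\<lambda>s. A *v x2 s + B *v u2 s" "x2 (t - T1) - x2 0" 0 "t - T1" "- T1"]
      by simp
    then show ?thesis by (rule has_integral_eq[rotated]) auto
  qed
  have ui: "?u integrable_on {0..T1 + T2}"
  proof (rule Henstock_Kurzweil_Integration.integrable_combine)
    have "u1 integrable_on {0..T1}" using s1 by (simp add: steers_def)
    then show "?u integrable_on {0..T1}"
      by (rule integrable_spike_finite[of "{T1}", rotated 2]) auto
    have "u2 integrable_on {0..T2}" using s2 by (simp add: steers_def)
    then have "(\<lambda>t. u2 (t - T1)) integrable_on {T1..T1 + T2}"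
      using has_integral_shift_real_ivl[of u2 _ 0 T2 "- T1"] unfolding integrable_on_def
      by (auto simp: add.commute)
    then show "?u integrable_on {T1..T1 + T2}"
      by (rule integrable_eq) auto
  qed (use T in auto)
  have "(?f has_integral (?x t - ?x 0)) {0..t}" if t: "t \<in> {0..T1 + T2}" for t
  proof (cases "t < T1")
    case True
    then show ?thesis using left[of t] t x0 by simp
  next
    case False
    have "(?f has_integral ((x1 T1 - x1 0) + (x2 (t - T1) - x2 0))) {0..t}"
      by (rule has_integral_combine[OF _ _ left right]) (use False t T in auto)
    then show ?thesis using False x0 join by simp
  qed
  then show ?thesis
    using s1 s2 ui unfolding steers_def by auto
qed

subsection \<open>Matrix exponential and controllability Gramian\<close>

lemma bounded_bilinear_matrix_matrix_mult:
  "bounded_bilinear ((**) :: real^'n^'m \<Rightarrow> real^'p^'n \<Rightarrow> real^'p^'m)"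
  unfolding bilinear_conv_bounded_bilinear[symmetric] bilinear_def
  by (auto intro!: linearI simp: matrix_matrix_mult_def vec_eq_iff algebra_simps sum.distrib sum_distrib_left)

lemma bounded_bilinear_matrix_vector_mult:
  "bounded_bilinear ((*v) :: real^'n^'m \<Rightarrow> real^'n \<Rightarrow> real^'m)"
  unfolding bilinear_conv_bounded_bilinear[symmetric] bilinear_def
  by (auto intro!: linearI simp: matrix_vector_mult_def vec_eq_iff algebra_simps sum.distrib sum_distrib_left)

lemma bounded_linear_transpose: "bounded_linear (transpose :: real^'n^'m \<Rightarrow> real^'m^'n)"
  unfolding linear_conv_bounded_linear[symmetric]
  by (auto intro!: linearI simp: transpose_def vec_eq_iff)

lemma has_vector_derivative_vec:
  fixes F :: "real \<Rightarrow> 'a::real_normed_vector^'n"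
  assumes "\<And>i. ((\<lambda>t. F t $ i) has_vector_derivative D $ i) (at t within S)"
  shows "(F has_vector_derivative D) (at t within S)"
  using assms unfolding has_vector_derivative_def has_derivative_within
  by (auto intro!: vec_tendstoI bounded_linear_scaleR_left)

primrec mat_pow :: "real^'n^'n \<Rightarrow> nat \<Rightarrow> real^'n^'n" where
  "mat_pow A 0 = mat 1"
| "mat_pow A (Suc k) = A ** mat_pow A k"

text \<open>This is exp(t A), written as one real power series per entry so that termwise
  differentiation of real series applies.\<close>

definition mexp :: "real^'n^'n \<Rightarrow> real \<Rightarrow> real^'n^'n" where
  "mexp A t = (\<chi> i j. \<Sum>k. (mat_pow A k $ i $ j / fact k) * t ^ k)"

lemma mat_pow_commute: "mat_pow A k ** A = A ** mat_pow A k"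
  by (induction k) (simp_all add: matrix_mul_assoc[symmetric])

lemma mat_pow_entry_bound:
  obtains L where "\<And>k i j. \<bar>mat_pow A k $ i $ j\<bar> \<le> L ^ k"
proof -
  define L where "L = onorm ((*v) A)"
  have bl: "bounded_linear ((*v) A)" by simp
  have L: "0 \<le> L" "\<And>v. norm (A *v v) \<le> L * norm v"
    by (auto simp: L_def onorm_pos_le[OF bl] onorm[OF bl])
  have pow: "norm (mat_pow A k *v v) \<le> L ^ k * norm v" for k v
  proof (induction k)
    case (Suc k)
    have "norm (mat_pow A (Suc k) *v v) \<le> L * norm (mat_pow A k *v v)"
      using L(2) by (simp add: matrix_vector_mul_assoc[symmetric])
    also have "\<dots> \<le> L * (L ^ k * norm v)" using Suc L(1) by (rule mult_left_mono)
    finally show ?case by (simp add: mult_ac)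
  qed simp
  show ?thesis
  proof
    fix k i j
    have "\<bar>mat_pow A k $ i $ j\<bar> = \<bar>(mat_pow A k *v axis j 1) $ i\<bar>"
      by (simp add: matrix_vector_mul_component inner_axis)
    also have "\<dots> \<le> norm (mat_pow A k *v axis j 1)" by (rule component_le_norm_cart)
    also have "\<dots> \<le> L ^ k" using pow[of k "axis j 1"] by simp
    finally show "\<bar>mat_pow A k $ i $ j\<bar> \<le> L ^ k" .
  qed
qed

lemma mexp_entry_summable: "summable (\<lambda>k. (mat_pow A k $ i $ j / fact k) * t ^ k)"
proof -
  obtain L where L: "\<And>k i j. \<bar>mat_pow A k $ i $ j\<bar> \<le> L ^ k" using mat_pow_entry_bound[of A] by metis
  show ?thesis
  proof (rule summable_comparison_test')
    show "summable (\<lambda>k. inverse (fact k) * (L * \<bar>t\<bar>) ^ k)" by (rule summable_exp)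
    show "norm (mat_pow A k $ i $ j / fact k * t ^ k) \<le> inverse (fact k) * (L * \<bar>t\<bar>) ^ k" for k
      using mult_right_mono[OF L[of k i j], of "\<bar>t\<bar> ^ k / fact k"]
      by (simp add: abs_mult power_abs power_mult_distrib divide_inverse mult_ac)
  qed
qed

text \<open>A matrix product is a finite sum in each entry, so it passes inside the series. With its
  mirror image below, this reduces commutation of \<open>A\<close> with \<open>mexp A t\<close> to
  commutation with the powers of \<open>A\<close>.\<close>

lemma mult_mexp_entry:
  "(M ** mexp A t) $ i $ j = (\<Sum>k. ((M ** mat_pow A k) $ i $ j / fact k) * t ^ k)"
proof -
  have "(M ** mexp A t) $ i $ j = (\<Sum>l\<in>UNIV. \<Sum>k. M $ i $ l * ((mat_pow A k $ l $ j / fact k) * t ^ k))"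
    by (simp only: matrix_matrix_mult_def mexp_def vec_lambda_beta suminf_mult[OF mexp_entry_summable])
  also have "\<dots> = (\<Sum>k. \<Sum>l\<in>UNIV. M $ i $ l * ((mat_pow A k $ l $ j / fact k) * t ^ k))"
    by (rule suminf_sum[symmetric]) (intro summable_mult mexp_entry_summable)
  also have "\<dots> = (\<Sum>k. ((M ** mat_pow A k) $ i $ j / fact k) * t ^ k)"
    by (simp add: matrix_matrix_mult_def sum_divide_distrib sum_distrib_right mult.assoc)
  finally show ?thesis .
qed

lemma mexp_mult_entry:
  "(mexp A t ** M) $ i $ j = (\<Sum>k. ((mat_pow A k ** M) $ i $ j / fact k) * t ^ k)"
proof -
  have "(mexp A t ** M) $ i $ j = (\<Sum>l\<in>UNIV. \<Sum>k. M $ l $ j * ((mat_pow A k $ i $ l / fact k) * t ^ k))"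
    by (simp only: matrix_matrix_mult_def mexp_def vec_lambda_beta suminf_mult[OF mexp_entry_summable])
      (rule sum.cong[OF refl mult.commute])
  also have "\<dots> = (\<Sum>k. \<Sum>l\<in>UNIV. M $ l $ j * ((mat_pow A k $ i $ l / fact k) * t ^ k))"
    by (rule suminf_sum[symmetric]) (intro summable_mult mexp_entry_summable)
  also have "\<dots> = (\<Sum>k. ((mat_pow A k ** M) $ i $ j / fact k) * t ^ k)"
    by (simp add: matrix_matrix_mult_def sum_divide_distrib sum_distrib_left mult_ac)
  finally show ?thesis .
qed

lemma mexp_commute: "mexp A t ** A = A ** mexp A t"
  by (simp add: vec_eq_iff mult_mexp_entry mexp_mult_entry mat_pow_commute)

lemma mexp_0: "mexp A 0 = mat 1"
proof -
  have "(\<Sum>k. (mat_pow A k $ i $ j / fact k) * 0 ^ k) = mat 1 $ i $ j" for i j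
    using powser_zero[of "\<lambda>k. mat_pow A k $ i $ j / fact k"] by simp
  then show ?thesis by (simp add: mexp_def vec_eq_iff)
qed

lemma mexp_has_vector_derivative: "(mexp A has_vector_derivative A ** mexp A t) (at t within S)"
proof (intro has_vector_derivative_vec)
  fix i j
  let ?c = "\<lambda>k. mat_pow A k $ i $ j / fact k"
  have "((\<lambda>t. \<Sum>k. ?c k * t ^ k) has_field_derivative (\<Sum>k. diffs ?c k * t ^ k)) (at t)"
    by (rule termdiffs_strong_converges_everywhere) (rule mexp_entry_summable)
  \<comment> \<open>Termwise differentiation shifts the index by one, and the factor
    \<open>Suc k\<close> cancels against the factorial.\<close>
  moreover have "diffs ?c k = (A ** mat_pow A k) $ i $ j / fact k" for k
    by (simp add: diffs_def fact_Suc del: of_nat_Suc)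
  ultimately have "((\<lambda>t. mexp A t $ i $ j) has_field_derivative (A ** mexp A t) $ i $ j) (at t)"
    by (simp add: mult_mexp_entry) (simp add: mexp_def)
  then show "((\<lambda>t. mexp A t $ i $ j) has_vector_derivative (A ** mexp A t) $ i $ j) (at t within S)"
    by (simp add: has_real_derivative_iff_has_vector_derivative has_vector_derivative_at_within)
qed

lemma mexp_compose_has_vector_derivative:
  assumes "(g has_real_derivative g') (at t within S)"
  shows "((\<lambda>t. mexp A (g t)) has_vector_derivative g' *\<^sub>R (A ** mexp A (g t))) (at t within S)"
  using vector_diff_chain_within[OF assms[unfolded has_real_derivative_iff_has_vector_derivative]
      mexp_has_vector_derivative[of A "g t" "g ` S"]]
  by (simp add: o_def)

lemma continuous_on_mexp: "continuous_on S (mexp A)"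
  by (meson continuous_on_eq_continuous_within has_vector_derivative_continuous mexp_has_vector_derivative)

lemmas matrix_mult_has_vector_derivative =
  bounded_bilinear.has_vector_derivative[OF bounded_bilinear_matrix_matrix_mult]

lemmas continuous_on_matrix_mult =
  bounded_bilinear.continuous_on[OF bounded_bilinear_matrix_matrix_mult]

lemma matrix_mult_minus_left: "(- M) ** N = - (M ** N)" for M :: "real^'n^'m"
  by (simp add: matrix_matrix_mult_def vec_eq_iff sum_negf)

lemma matrix_mult_minus_right: "M ** (- N) = - (M ** N)" for M :: "real^'n^'m"
  by (simp add: matrix_matrix_mult_def vec_eq_iff sum_negf)

lemma transpose_minus: "transpose (- M) = - transpose M" for M :: "real^'n^'m"
  by (simp add: transpose_def vec_eq_iff)

text \<open>The two terms of the derivative cancel because \<open>A\<close> commutes with its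
  exponential, so the product keeps its value at time 0.\<close>

lemma mexp_mult_mexp_minus: "mexp A t ** mexp A (- t) = mat 1"
proof -
  have "((\<lambda>t. mexp A t ** mexp A (- t)) has_vector_derivative 0) (at s within UNIV)" for s
  proof -
    have "((\<lambda>t. mexp A (- t)) has_vector_derivative - (A ** mexp A (- s))) (at s)"
      using mexp_compose_has_vector_derivative[OF DERIV_minus[OF DERIV_ident], of A s UNIV] by simp
    from matrix_mult_has_vector_derivative[OF mexp_has_vector_derivative[of A s UNIV] this]
    show ?thesis
      by (simp add: matrix_mult_minus_right matrix_mul_assoc mexp_commute)
  qed
  then obtain c where "\<And>t. mexp A t ** mexp A (- t) = c"
    using has_vector_derivative_zero_constant[of UNIV "\<lambda>t. mexp A t ** mexp A (- t)"] by auto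
  from this[of t] this[of 0] show ?thesis by (simp add: mexp_0)
qed

lemma has_vector_derivative_imp_has_integral:
  fixes F :: "real \<Rightarrow> 'a::banach"
  assumes "\<And>s. s \<in> {0..T} \<Longrightarrow> (F has_vector_derivative f s) (at s within {0..T})" "t \<in> {0..T}"
  shows "(f has_integral (F t - F 0)) {0..t}"
proof (rule fundamental_theorem_of_calculus)
  show "(F has_vector_derivative f s) (at s within {0..t})" if "s \<in> {0..t}" for s
    using assms(1)[of s] by (rule has_vector_derivative_within_subset) (use that assms(2) in auto)
qed (use assms(2) in auto)

text \<open>\<open>gramian A B t\<close> maps \<open>p\<close> to the state reached from \<open>0\<close> at time \<open>t\<close> under the control
  \<open>s \<mapsto> B\<^sup>T exp(A (1 - s))\<^sup>T p\<close>; at \<open>t = 1\<close> it is the controllability Gramian.\<close>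

definition gramian_control :: "real^'n^'n \<Rightarrow> real^'m^'n \<Rightarrow> real \<Rightarrow> real^'n^'m" where
  "gramian_control A B s = transpose (mexp A (1 - s) ** B)"

definition gramian :: "real^'n^'n \<Rightarrow> real^'m^'n \<Rightarrow> real \<Rightarrow> real^'n^'n" where
  "gramian A B t = mexp A t ** integral {0..t} (\<lambda>s. mexp A (- s) ** (B ** gramian_control A B s))"

lemma mexp_one_minus_has_vector_derivative:
  "((\<lambda>s. mexp A (1 - s)) has_vector_derivative - (A ** mexp A (1 - s))) (at s within S)"
  using mexp_compose_has_vector_derivative[OF DERIV_diff[OF DERIV_const DERIV_ident], of A 1 s S] by simp

lemma continuous_on_gramian_control: "continuous_on S (gramian_control A B)"
  unfolding gramian_control_def
  by (intro bounded_linear.continuous_on[OF bounded_linear_transpose] continuous_on_matrix_mult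
      continuous_on_compose2[OF continuous_on_mexp[of UNIV]] continuous_intros) auto

lemma gramian_0: "gramian A B 0 = 0"
  by (simp add: gramian_def matrix_matrix_mult_def vec_eq_iff)

text \<open>Variation of constants: when the integral is differentiated, the outer
  \<open>mexp A t\<close> cancels against \<open>mexp A (- t)\<close>.\<close>

lemma gramian_has_vector_derivative:
  assumes t: "t \<in> {0..1}"
  shows "(gramian A B has_vector_derivative A ** gramian A B t + B ** gramian_control A B t) (at t within {0..1})"
proof -
  let ?k = "\<lambda>s. mexp A (- s) ** (B ** gramian_control A B s)"
  have "continuous_on {0..1} ?k"
    by (intro continuous_on_matrix_mult continuous_on_gramian_control
        continuous_on_compose2[OF continuous_on_mexp[of UNIV]] continuous_intros) auto
  from integral_has_vector_derivative[OF this t]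
  have "((\<lambda>t. integral {0..t} ?k) has_vector_derivative ?k t) (at t within {0..1})" .
  from matrix_mult_has_vector_derivative[OF mexp_has_vector_derivative[of A t] this]
  show ?thesis
    unfolding gramian_def[abs_def]
    by (simp add: matrix_mul_assoc mexp_mult_mexp_minus add.commute)
qed

text \<open>Multiplying \<open>gramian A B s\<close> by \<open>mexp A (1 - s)\<close> removes the
  drift: the derivative of the product is a matrix times its own transpose. Integration gives the
  usual symmetric form of the Gramian.\<close>

lemma gramian_1_form:
  "((\<lambda>s. (norm (gramian_control A B s *v p))\<^sup>2) has_integral p \<bullet> (gramian A B 1 *v p)) {0..1}"
proof -
  let ?K = "\<lambda>s. mexp A (1 - s) ** B"
  have d: "((\<lambda>s. mexp A (1 - s) ** gramian A B s) has_vector_derivative ?K s ** gramian_control A B s)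
      (at s within {0..1})" if "s \<in> {0..1}" for s
    using matrix_mult_has_vector_derivative[OF mexp_one_minus_has_vector_derivative[of A s]
        gramian_has_vector_derivative[OF that, of A B]]
    by (simp add: matrix_mult_minus_left matrix_add_ldistrib matrix_mul_assoc mexp_commute)
  have "((\<lambda>s. ?K s ** gramian_control A B s) has_integral gramian A B 1) {0..1}"
    using has_vector_derivative_imp_has_integral[OF d, of 1] by (simp add: mexp_0 gramian_0)
  moreover have "bounded_linear (\<lambda>M. p \<bullet> (M *v p))"
    by (rule bounded_linear_compose[OF bounded_linear_inner_right
        bounded_bilinear.bounded_linear_left[OF bounded_bilinear_matrix_vector_mult]])
  ultimately have "((\<lambda>s. p \<bullet> ((?K s ** gramian_control A B s) *v p)) has_integral p \<bullet> (gramian A B 1 *v p)) {0..1}"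
    by (rule has_integral_linear[unfolded o_def])
  moreover have "p \<bullet> ((?K s ** gramian_control A B s) *v p) = (norm (gramian_control A B s *v p))\<^sup>2" for s
    unfolding matrix_vector_mul_assoc[of "?K s" _ p, symmetric] inner_matrix_vector_mult[of p "?K s"]
      gramian_control_def power2_norm_eq_inner ..
  ultimately show ?thesis by simp
qed

lemma controllable_orthogonal_zero:
  fixes A :: "real^'n^'n" and B :: "real^'m^'n"
  assumes ctr: "controllable A B" and p: "\<And>k. transpose (((**) A ^^ k) B) *v p = 0"
  shows "p = 0"
proof -
  let ?S = "\<Union>k<CARD('n). columns (((**) A ^^ k) B)"
  have "span ?S = UNIV"
    using ctr by (simp add: controllable_def dim_eq_full[symmetric])
  moreover have "orthogonal p c" if c: "c \<in> ?S" for c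
  proof -
    obtain k j where "c = column j (((**) A ^^ k) B)" using c unfolding columns_def by blast
    moreover have "(transpose (((**) A ^^ k) B) *v p) $ j = 0" using p[of k] by simp
    ultimately show ?thesis
      by (simp add: orthogonal_def inner_vec_def column_def vector_matrix_mult_def mult.commute)
  qed
  ultimately have "orthogonal p p"
    using orthogonal_to_span[of p ?S p] by auto
  then show ?thesis by (simp add: orthogonal_def)
qed

text \<open>For \<open>p\<close> in the kernel, the squared norm of
  \<open>gramian_control A B s *v p\<close> has zero integral, so this function vanishes on the unit
  interval. Each differentiation in \<open>s\<close> brings out another factor \<open>A\<close>, and
  at \<open>s = 1\<close> the exponential is the identity; so \<open>p\<close> is orthogonal to all
  blocks of the controllability matrix.\<close>

lemma gramian_1_kernel:
  assumes ctr: "controllable A B" and p: "gramian A B 1 *v p = 0"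
  shows "p = 0"
proof -
  have cont: "continuous_on {0..1} (\<lambda>s. (norm (gramian_control A B s *v p))\<^sup>2)"
    by (intro continuous_intros continuous_on_gramian_control
        bounded_bilinear.continuous_on[OF bounded_bilinear_matrix_vector_mult])
  have "integral {0..1} (\<lambda>s. (norm (gramian_control A B s *v p))\<^sup>2) = 0"
    using integral_unique[OF gramian_1_form[of A B p]] p by simp
  then have z: "gramian_control A B s *v p = 0" if "s \<in> {0..1}" for s
    using integral_eq_0_iff[OF cont] that by simp
  have zk: "\<forall>s\<in>{0..1}. transpose (mexp A (1 - s) ** ((**) A ^^ k) B) *v p = 0" for k
  proof (induction k)
    case 0
    then show ?case using z by (simp add: gramian_control_def)
  next
    case (Suc k)
    define N where "N = ((**) A ^^ k) B"
    show ?case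
    proof
      fix s :: real assume s: "s \<in> {0..1}"
      let ?f = "\<lambda>s. transpose (mexp A (1 - s) ** N) *v p"
      have bl: "bounded_linear (\<lambda>M. transpose (M ** N) *v p)"
        by (intro bounded_linear_compose[OF bounded_bilinear.bounded_linear_left[OF bounded_bilinear_matrix_vector_mult]]
            bounded_linear_compose[OF bounded_linear_transpose]
            bounded_bilinear.bounded_linear_left[OF bounded_bilinear_matrix_matrix_mult])
      from bounded_linear.has_vector_derivative[OF this mexp_one_minus_has_vector_derivative[of A s "{0..1}"]]
      have "(?f has_vector_derivative transpose (- (A ** mexp A (1 - s)) ** N) *v p) (at s within {0..1})" .
      moreover have "(?f has_vector_derivative 0) (at s within {0..1})"
        by (rule has_vector_derivative_transform[of _ _ _ "\<lambda>_. 0"]) (use s Suc in \<open>auto simp: N_def\<close>)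
      ultimately have "transpose (- (A ** mexp A (1 - s)) ** N) *v p = 0"
        using vector_derivative_unique_within_closed_interval[of 0 1 s ?f] s by simp
      moreover have "- (A ** mexp A (1 - s)) ** N = - (mexp A (1 - s) ** ((**) A ^^ Suc k) B)"
        by (simp add: N_def matrix_mul_assoc mexp_commute matrix_mult_minus_left)
      ultimately have "transpose (- (mexp A (1 - s) ** ((**) A ^^ Suc k) B)) *v p = 0" by simp
      then show "transpose (mexp A (1 - s) ** ((**) A ^^ Suc k) B) *v p = 0"
        by (simp add: transpose_minus bounded_bilinear.minus_left[OF bounded_bilinear_matrix_vector_mult])
    qed
  qed
  show ?thesis
  proof (rule controllable_orthogonal_zero[OF ctr])
    show "transpose (((**) A ^^ k) B) *v p = 0" for k
      using zk[of k] by (auto dest!: bspec[of _ _ 1] simp: mexp_0)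
  qed
qed

subsection \<open>Steering to the origin with small controls\<close>

lemma continuous_matrix_family_bounded:
  fixes N :: "real \<Rightarrow> real^'n^'m"
  assumes "continuous_on {a..b} N"
  obtains c where "c \<ge> 0" "\<And>t v. t \<in> {a..b} \<Longrightarrow> norm (N t *v v) \<le> c * norm v"
proof -
  obtain K where K: "K > 0" "\<And>(M :: real^'n^'m) v. norm (M *v v) \<le> norm M * norm v * K"
    using bounded_bilinear.pos_bounded[OF bounded_bilinear_matrix_vector_mult] by metis
  have "bounded (N ` {a..b})"
    using assms by (intro compact_imp_bounded compact_continuous_image) auto
  then obtain c where c: "c > 0" "\<And>t. t \<in> {a..b} \<Longrightarrow> norm (N t) \<le> c"
    unfolding bounded_pos by blast
  show ?thesis
  proof (rule that[of "c * K"])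
    fix t v assume t: "t \<in> {a..b}"
    have "norm (N t *v v) \<le> norm (N t) * norm v * K" by (rule K(2))
    also have "\<dots> \<le> c * norm v * K"
      using c(2)[OF t] K by (intro mult_right_mono) auto
    finally show "norm (N t *v v) \<le> c * K * norm v" by (simp add: mult_ac)
  qed (use c K in auto)
qed

lemma steers_of_derivative:
  assumes x: "\<And>s. s \<in> {0..T} \<Longrightarrow> (x has_vector_derivative A *v x s + B *v u s) (at s within {0..T})"
    and "\<And>t. u t \<in> U" "u integrable_on {0..T}"
  shows "steers A B U T u x"
  unfolding steers_def using assms(2,3) has_vector_derivative_imp_has_integral[OF x] by blast

lemma mexp_vector_has_vector_derivative:
  "((\<lambda>t. mexp A t *v a) has_vector_derivative A *v (mexp A t *v a)) (at t within S)"
  using bounded_linear.has_vector_derivative[OF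
      bounded_bilinear.bounded_linear_left[OF bounded_bilinear_matrix_vector_mult] mexp_has_vector_derivative]
  by (simp add: matrix_vector_mul_assoc)

text \<open>Inverting the Gramian gives a control that adds \<open>z\<close> to the free motion. Its
  size is bounded by \<open>z\<close> and not by the initial state \<open>a\<close>, so large states
  can be corrected with small controls.\<close>

lemma controllable_one_step:
  fixes A :: "real^'n^'n" and B :: "real^'m^'n"
  assumes ctr: "controllable A B"
  obtains M where "M \<ge> 0"
    "\<And>a z. \<exists>u x. steers A B (cball 0 (M * norm z)) 1 u x \<and> x 0 = a \<and> x 1 = mexp A 1 *v a + z \<and>
       (\<forall>t\<in>{0..1}. norm (x t) \<le> M * (norm a + norm z))"
proof -
  let ?W = "(*v) (gramian A B 1)"
  have "inj ?W"
    using gramian_1_kernel[OF ctr] by (intro linear_injective_0[THEN iffD2]) auto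
  then have surj: "surj ?W"
    by (intro linear_injective_imp_surjective) auto
  obtain e where e: "e > 0" "\<And>p. e * norm p \<le> norm (?W p)"
    using injective_imp_isometric[of UNIV ?W] gramian_1_kernel[OF ctr] by auto
  obtain c1 where c1: "c1 \<ge> 0" "\<And>t v. t \<in> {0..1} \<Longrightarrow> norm (mexp A t *v v) \<le> c1 * norm v"
    using continuous_matrix_family_bounded[OF continuous_on_mexp[of "{0..1}" A]] by metis
  obtain c2 where c2: "c2 \<ge> 0" "\<And>t v. t \<in> {0..1} \<Longrightarrow> norm (gramian_control A B t *v v) \<le> c2 * norm v"
    using continuous_matrix_family_bounded[OF continuous_on_gramian_control[of "{0..1}" A B]] by metis
  have "continuous_on {0..1} (gramian A B)"
    by (meson continuous_on_eq_continuous_within gramian_has_vector_derivative has_vector_derivative_continuous)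
  then obtain c3 where c3: "c3 \<ge> 0" "\<And>t v. t \<in> {0..1} \<Longrightarrow> norm (gramian A B t *v v) \<le> c3 * norm v"
    using continuous_matrix_family_bounded by metis
  \<comment> \<open>\<open>c1\<close> bounds the free motion, \<open>c2 / e\<close> the control per
    unit of \<open>z\<close>, and \<open>c3 / e\<close> the forced part of the state; the sum serves
    for all three.\<close>
  define M where "M = c1 + c2 / e + c3 / e"
  have pos: "0 \<le> c2 / e" "0 \<le> c3 / e" using c2 c3 e by auto
  show ?thesis
  proof (rule that)
    show "M \<ge> 0" using c1 pos by (simp add: M_def)
    fix a z :: "real^'n"
    obtain p where p: "?W p = z" using surj by (metis surjD)
    have np: "norm p \<le> norm z / e" using e(2)[of p] e(1) by (simp add: p field_simps)
    \<comment> \<open>Outside the unit interval the control is 0, since \<open>steers\<close>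
      restricts its values at all times.\<close>
    define u where "u = (\<lambda>t. if t \<in> {0..1} then gramian_control A B t *v p else 0)"
    define x where "x = (\<lambda>t. mexp A t *v a + gramian A B t *v p)"
    have "steers A B (cball 0 (M * norm z)) 1 u x"
    proof (rule steers_of_derivative)
      fix s :: real assume s: "s \<in> {0..1}"
      have "((\<lambda>t. gramian A B t *v p) has_vector_derivative
          (A ** gramian A B s + B ** gramian_control A B s) *v p) (at s within {0..1})"
        by (rule bounded_linear.has_vector_derivative[OF
            bounded_bilinear.bounded_linear_left[OF bounded_bilinear_matrix_vector_mult]
            gramian_has_vector_derivative[OF s]])
      from has_vector_derivative_add[OF mexp_vector_has_vector_derivative[of A a s] this]
      show "(x has_vector_derivative A *v x s + B *v u s) (at s within {0..1})"
        using s by (simp add: x_def u_def matrix_vector_right_distrib matrix_vector_mult_add_rdistrib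
            matrix_vector_mul_assoc add.assoc)
    next
      have "(\<lambda>t. gramian_control A B t *v p) integrable_on {0..1}"
        by (intro integrable_continuous_real continuous_on_gramian_control continuous_intros
            bounded_bilinear.continuous_on[OF bounded_bilinear_matrix_vector_mult])
      then show "u integrable_on {0..1}"
        by (rule integrable_eq) (simp add: u_def)
      show "u t \<in> cball 0 (M * norm z)" for t
      proof (cases "t \<in> {0..1}")
        case True
        then have "norm (u t) \<le> c2 * norm p" using c2(2)[of t p] by (simp add: u_def)
        also have "\<dots> \<le> c2 * (norm z / e)" using np c2 by (intro mult_left_mono)
        also have "\<dots> = (c2 / e) * norm z" by simp
        also have "\<dots> \<le> M * norm z"
          using c1 pos by (intro mult_right_mono) (auto simp: M_def)
        finally show ?thesis by simp
      qed (use \<open>M \<ge> 0\<close> in \<open>auto simp: u_def\<close>)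
    qed
    moreover have "x 0 = a" "x 1 = mexp A 1 *v a + z"
      by (simp_all add: x_def mexp_0 gramian_0 p)
    moreover have "norm (x t) \<le> M * (norm a + norm z)" if t: "t \<in> {0..1}" for t
    proof -
      have "norm (x t) \<le> c1 * norm a + c3 * norm p"
        unfolding x_def by (intro norm_triangle_mono c1 c3 t)
      also have "c3 * norm p \<le> c3 * (norm z / e)" using np c3 by (intro mult_left_mono)
      also have "c3 * (norm z / e) = (c3 / e) * norm z" by simp
      also have "c1 * norm a + (c3 / e) * norm z \<le> M * norm a + M * norm z"
        using c1 pos by (intro add_mono mult_right_mono) (auto simp: M_def)
      finally show ?thesis by (simp add: algebra_simps)
    qed
    ultimately show "\<exists>u x. steers A B (cball 0 (M * norm z)) 1 u x \<and> x 0 = a \<and> x 1 = mexp A 1 *v a + z \<and>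
       (\<forall>t\<in>{0..1}. norm (x t) \<le> M * (norm a + norm z))" by blast
  qed
qed

section \<open>Boundedness of the free motion\<close>

lemma pos_def_imp_pos_semidef: "pos_def M \<Longrightarrow> pos_semidef M"
  unfolding pos_def_def pos_semidef_def by (metis inner_zero_left less_imp_le order_refl)

lemma inner_matrix_sqrt:
  assumes "pos_semidef M"
  shows "x \<bullet> (M *v x) = (norm (matrix_sqrt M *v x))\<^sup>2"
proof -
  have "x \<bullet> (M *v x) = x \<bullet> (matrix_sqrt M *v (matrix_sqrt M *v x))"
    by (simp add: matrix_vector_mul_assoc matrix_sqrt_mult_self[OF assms])
  also have "\<dots> = (transpose (matrix_sqrt M) *v x) \<bullet> (matrix_sqrt M *v x)"
    by (rule inner_matrix_vector_mult)
  also have "transpose (matrix_sqrt M) = matrix_sqrt M"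
    using pos_semidef_matrix_sqrt[OF assms] by (simp add: pos_semidef_def)
  finally show ?thesis by (simp add: power2_norm_eq_inner)
qed

lemma mexp_energy_nonincreasing:
  assumes Q: "transpose Q = Q" and diss: "\<And>x. (Q *v x) \<bullet> (A *v x) \<le> 0"
  shows "(mexp A 1 *v y) \<bullet> (Q *v (mexp A 1 *v y)) \<le> y \<bullet> (Q *v y)"
proof -
  \<comment> \<open>The free motion is a trajectory under zero control; the identity serves as a
    placeholder input matrix.\<close>
  have "steers A (mat 1) {0} 1 (\<lambda>_. 0) (\<lambda>t. mexp A t *v y)"
    using mexp_vector_has_vector_derivative
    by (intro steers_of_derivative) (auto simp: integrable_0)
  from steers_energy_balance[OF this _ _ Q]
  have "((\<lambda>t. (Q *v (mexp A t *v y)) \<bullet> (A *v (mexp A t *v y))) has_integral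
      (((mexp A 1 *v y) \<bullet> (Q *v (mexp A 1 *v y))) / 2 - (y \<bullet> (Q *v y)) / 2)) {0..1}"
    by (simp add: mexp_0)
  moreover have "((\<lambda>t. 0) has_integral (0::real)) {0..1::real}" by simp
  ultimately have "((mexp A 1 *v y) \<bullet> (Q *v (mexp A 1 *v y))) / 2 - (y \<bullet> (Q *v y)) / 2 \<le> 0"
    by (rule has_integral_le) (rule diss)
  then show ?thesis by simp
qed

text \<open>The norm of \<open>matrix_sqrt Q *v y\<close> never grows along the free motion and is
  equivalent to the Euclidean norm. Uniformity in \<open>k\<close> matters: the number of steps is
  chosen after \<open>C\<close>.\<close>

lemma free_motion_bounded:
  assumes Q: "pos_def Q" and diss: "\<And>x. (Q *v x) \<bullet> (A *v x) \<le> 0"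
  obtains C where "C \<ge> 0" "\<And>k b. norm (((*v) (mexp A 1) ^^ k) b) \<le> C * norm b"
proof -
  have Qp: "pos_semidef Q" using Q by (rule pos_def_imp_pos_semidef)
  have Qt: "transpose Q = Q" using Q by (simp add: pos_def_def)
  let ?S = "matrix_sqrt Q"
  have "matrix_ker ?S = {0}"
  proof -
    have "x = 0" if "?S *v x = 0" for x
      using Q inner_matrix_sqrt[OF Qp, of x] that by (auto simp: pos_def_def)
    then show ?thesis by (auto simp: matrix_ker_def)
  qed
  then obtain e where e: "e > 0" "\<And>x. e * norm x \<le> norm (?S *v x)"
    using matrix_norm_ge_infdist_ker[of ?S] by (auto simp: infdist_def)
  let ?L = "onorm ((*v) ?S)"
  have bl: "bounded_linear ((*v) ?S)" by simp
  have mono: "norm (?S *v ((*v) (mexp A 1) ^^ k) b) \<le> norm (?S *v b)" for k b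
  proof (induction k)
    case (Suc k)
    have "(norm (?S *v ((*v) (mexp A 1) ^^ Suc k) b))\<^sup>2 \<le> (norm (?S *v ((*v) (mexp A 1) ^^ k) b))\<^sup>2"
      using mexp_energy_nonincreasing[OF Qt diss] by (simp add: inner_matrix_sqrt[OF Qp, symmetric])
    then have "norm (?S *v ((*v) (mexp A 1) ^^ Suc k) b) \<le> norm (?S *v ((*v) (mexp A 1) ^^ k) b)"
      by (rule power2_le_imp_le) simp
    with Suc show ?case by (rule order_trans[rotated])
  qed simp
  show ?thesis
  proof (rule that[of "?L / e"])
    show "0 \<le> ?L / e" using e onorm_pos_le[OF bl] by simp
    fix k b
    have "e * norm (((*v) (mexp A 1) ^^ k) b) \<le> ?L * norm b"
      using e(2) mono onorm[OF bl] by (meson order_trans)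
    then show "norm (((*v) (mexp A 1) ^^ k) b) \<le> ?L / e * norm b"
      using e(1) by (simp add: field_simps)
  qed
qed

text \<open>In \<open>N\<close> unit time steps the state is moved along \<open>(1 - k/N) exp(kA) b\<close>. Since the free motion is
  bounded, each step requires only a correction of size \<open>O(1/N)\<close>, hence a small control.\<close>

lemma steer_to_zero:
  fixes A :: "real^'n^'n" and B :: "real^'m^'n"
  assumes ctr: "controllable A B" and Q: "pos_def Q" and diss: "\<And>x. (Q *v x) \<bullet> (A *v x) \<le> 0"
    and r: "r \<ge> 0" and \<eta>: "\<eta> > 0"
  obtains N D where "N > 0" "D \<ge> 0"
    "\<And>b. norm b \<le> r \<Longrightarrow> \<exists>u x. steers A B (cball 0 \<eta>) N u x \<and> x 0 = b \<and> x N = 0 \<and> (\<forall>t\<in>{0..N}. norm (x t) \<le> D)"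
proof -
  obtain M where M: "M \<ge> 0"
    "\<And>a z. \<exists>u x. steers A B (cball 0 (M * norm z)) 1 u x \<and> x 0 = a \<and> x 1 = mexp A 1 *v a + z \<and>
       (\<forall>t\<in>{0..1}. norm (x t) \<le> M * (norm a + norm z))"
    using controllable_one_step[OF ctr] by metis
  obtain C where C: "C \<ge> 0" "\<And>k b. norm (((*v) (mexp A 1) ^^ k) b) \<le> C * norm b"
    using free_motion_bounded[OF Q diss] by metis
  \<comment> \<open>A correction has norm at most \<open>C * r / n\<close> and needs a control of
    norm at most \<open>M\<close> times that, which has to stay within \<eta>.\<close>
  obtain n :: nat where n: "M * (C * r) / \<eta> < real n" using reals_Archimedean2 by blast
  have "real n > 0" using n M C r \<eta> by (smt (verit) divide_nonneg_pos mult_nonneg_nonneg)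
  then have n0: "n > 0" by simp
  have small: "M * (C * r / n) \<le> \<eta>"
    using n \<eta> \<open>real n > 0\<close> by (simp add: field_simps)
  \<comment> \<open>\<open>r\<close> covers the starting point and the second summand every unit
    step; the bound depends neither on \<open>b\<close> nor on \<open>n\<close>.\<close>
  define D where "D = r + M * (C * r + C * r)"
  have D: "r \<le> D" "M * (C * r + C * r) \<le> D" "0 \<le> D" using r M C by (auto simp: D_def)
  have steps: "\<exists>u x. steers A B (cball 0 \<eta>) (real k) u x \<and> x 0 = b \<and>
      x (real k) = (1 - real k / real n) *\<^sub>R ((*v) (mexp A 1) ^^ k) b \<and> (\<forall>t\<in>{0..real k}. norm (x t) \<le> D)"
    if b: "norm b \<le> r" and "k \<le> n" for b k
    using \<open>k \<le> n\<close>
  proof (induction k)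
    case 0
    have "steers A B (cball 0 \<eta>) 0 (\<lambda>_. 0) (\<lambda>_. b)"
      using \<eta> by (auto simp: steers_def integrable_0)
    then show ?case using b D by (intro exI[of _ "\<lambda>_. 0"] exI[of _ "\<lambda>_. b"]) auto
  next
    case (Suc k)
    define y where "y = ((*v) (mexp A 1) ^^ k) b"
    define y' where "y' = ((*v) (mexp A 1) ^^ Suc k) b"
    have y': "y' = mexp A 1 *v y" by (simp add: y_def y'_def)
    have Cb: "C * norm b \<le> C * r" using b C by (intro mult_left_mono)
    have ny: "norm y \<le> C * r" "norm y' \<le> C * r"
      using C(2)[of k b] C(2)[of "Suc k" b] Cb by (auto simp: y_def y'_def simp del: funpow.simps)
    from Suc obtain u1 x1 where 1: "steers A B (cball 0 \<eta>) (real k) u1 x1" "x1 0 = b"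
      "x1 (real k) = (1 - real k / real n) *\<^sub>R y" "\<And>t. t \<in> {0..real k} \<Longrightarrow> norm (x1 t) \<le> D"
      by (auto simp: y_def)
    define a where "a = (1 - real k / real n) *\<^sub>R y"
    \<comment> \<open>The free motion carries \<open>a\<close> to \<open>(1 - k / n) y'\<close>, so
      subtracting \<open>y' / n\<close> lands on the next point of the shrinking path. After
      \<open>n\<close> steps the factor is zero.\<close>
    define z where "z = - (1 / real n) *\<^sub>R y'"
    have nz: "norm z \<le> C * r / real n" using ny n0 by (simp add: z_def divide_right_mono)
    have "C * r / real n \<le> C * r / 1" using n0 C r by (intro divide_left_mono) auto
    with nz have nz': "norm z \<le> C * r" by simp
    have na: "norm a \<le> C * r"
    proof -
      have "\<bar>1 - real k / real n\<bar> \<le> 1" using Suc.prems n0 by (simp add: field_simps)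
      then have "norm a \<le> 1 * norm y" unfolding a_def norm_scaleR by (intro mult_right_mono) auto
      then show ?thesis using ny by simp
    qed
    obtain u2 x2 where 2: "steers A B (cball 0 (M * norm z)) 1 u2 x2" "x2 0 = a"
      "x2 1 = mexp A 1 *v a + z" "\<And>t. t \<in> {0..1} \<Longrightarrow> norm (x2 t) \<le> M * (norm a + norm z)"
      using M(2)[of z a] by blast
    have "M * norm z \<le> \<eta>"
      using small mult_left_mono[OF nz M(1)] by simp
    then have s2: "steers A B (cball 0 \<eta>) 1 u2 x2"
      using 2(1) by (rule steers_mono[OF _ subset_cball, rotated])
    have x2D: "norm (x2 t) \<le> D" if "t \<in> {0..1}" for t
    proof -
      have "M * (norm a + norm z) \<le> M * (C * r + C * r)"
        using M(1) na nz' by (intro mult_left_mono add_mono)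
      then show ?thesis using 2(4)[OF that] D(2) by linarith
    qed
    have x2e: "x2 1 = (1 - real (Suc k) / real n) *\<^sub>R y'"
      using n0 by (simp add: 2 a_def z_def y' matrix_vector_mult_scaleR algebra_simps add_divide_distrib)
    let ?u = "\<lambda>t. if t < real k then u1 t else u2 (t - real k)"
    let ?x = "\<lambda>t. if t < real k then x1 t else x2 (t - real k)"
    have "steers A B (cball 0 \<eta>) (real k + 1) ?u ?x"
      using 1 2 s2 by (intro steers_concat) (auto simp: a_def)
    moreover have "?x 0 = b" using 1 2 by (auto simp: a_def)
    moreover have "?x (real (Suc k)) = (1 - real (Suc k) / real n) *\<^sub>R y'" using x2e by simp
    moreover have "\<forall>t\<in>{0..real (Suc k)}. norm (?x t) \<le> D" using 1(4) x2D by auto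
    ultimately show ?case
      unfolding y'_def[symmetric] by (intro exI[of _ ?u] exI[of _ ?x]) (simp add: add.commute)
  qed
  show ?thesis
  proof (rule that[of "real n" D])
    show "real n > 0" "D \<ge> 0" by fact+
    show "\<exists>u x. steers A B (cball 0 \<eta>) (real n) u x \<and> x 0 = b \<and> x (real n) = 0 \<and> (\<forall>t\<in>{0..real n}. norm (x t) \<le> D)"
      if "norm b \<le> r" for b
      using steps[OF that order_refl] n0 by auto
  qed
qed

subsection \<open>Dissipativity and turnpike\<close>

lemma supply_cost_eq: "supply_cost B Q x u = (Q *v x) \<bullet> (B *v u)"
proof -
  have "supply_cost B Q x u = u \<bullet> (transpose B *v (Q *v x))"
    by (simp only: supply_cost_def matrix_vector_mul_assoc[of "transpose B" Q x])
  also have "\<dots> = (B *v u) \<bullet> (Q *v x)"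
    by (simp only: inner_matrix_vector_mult[of u "transpose B"] transpose_transpose)
  finally show ?thesis by (simp add: inner_commute)
qed

text \<open>The skew part \<open>J\<close> does no work on \<open>y = Q *v x\<close>, and the form
  of \<open>R\<close> at \<open>y\<close> is a squared norm. The left side is the rate of change of
  the storage function.\<close>

lemma power_balance:
  fixes J R Q :: "real^'n^'n" and B :: "real^'m^'n"
  assumes J: "transpose J = - J" and R: "pos_semidef R"
  shows "(Q *v x) \<bullet> (((J - R) ** Q) *v x + B *v u)
           = supply_cost B Q x u - (norm ((matrix_sqrt R ** Q) *v x))\<^sup>2"
proof -
  define y where "y = Q *v x"
  have "y \<bullet> (J *v y) = (transpose J *v y) \<bullet> y" by (rule inner_matrix_vector_mult)
  also have "\<dots> = - (y \<bullet> (J *v y))"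
    unfolding J by (simp add: bounded_bilinear.minus_left[OF bounded_bilinear_matrix_vector_mult] inner_commute)
  finally have "y \<bullet> (J *v y) = 0" by simp
  then have "y \<bullet> ((J - R) *v y) = - (norm (matrix_sqrt R *v y))\<^sup>2"
    using inner_matrix_sqrt[OF R, of y] by (simp add: matrix_vector_mult_diff_rdistrib inner_diff_right)
  then show ?thesis
    by (simp add: supply_cost_eq y_def inner_add_right flip: matrix_vector_mul_assoc)
qed

lemma absolutely_integrable_supply_cost:
  assumes st: "steers A B U T u x" and U: "bounded U"
  shows "(\<lambda>t. supply_cost B Q (x t) (u t)) absolutely_integrable_on {0..T}"
  unfolding supply_cost_eq
proof (rule absolutely_integrable_bilinear_continuous[OF bounded_bilinear_inner])
  show "continuous_on {0..T} (\<lambda>t. Q *v x t)"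
    using steers_continuous[OF st] by (rule bounded_linear.continuous_on[OF matrix_vector_mul_bounded_linear])
  show "(\<lambda>t. B *v u t) absolutely_integrable_on {0..T}"
    using st U unfolding steers_def
    by (intro absolutely_integrable_matrix_vector_mult absolutely_integrable_of_bounded_range[of _ _ _ U]) auto
qed

text \<open>Integrated balance: for fixed boundary values the supplied energy and the dissipation
  differ by a constant, so a bound on the cost is a bound on the dissipation.\<close>

lemma steers_total_cost:
  fixes J R Q :: "real^'n^'n" and B :: "real^'m^'n"
  assumes J: "transpose J = - J" and R: "pos_semidef R" and Q: "transpose Q = Q"
    and st: "steers ((J - R) ** Q) B U T u x" and U: "bounded U" and T: "0 \<le> T"
  shows "total_cost (supply_cost B Q) T u x = integral {0..T} (\<lambda>t. (norm ((matrix_sqrt R ** Q) *v x t))\<^sup>2)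
           + (x T \<bullet> (Q *v x T)) / 2 - (x 0 \<bullet> (Q *v x 0)) / 2"
proof -
  let ?d = "\<lambda>t. (norm ((matrix_sqrt R ** Q) *v x t))\<^sup>2"
  let ?c = "\<lambda>t. supply_cost B Q (x t) (u t)"
  have "?d integrable_on {0..T}"
    by (intro integrable_continuous_real continuous_intros
        bounded_linear.continuous_on[OF matrix_vector_mul_bounded_linear] steers_continuous[OF st])
  moreover have "?c absolutely_integrable_on {0..T}"
    by (rule absolutely_integrable_supply_cost[OF st U])
  moreover have "((\<lambda>t. ?c t - ?d t) has_integral ((x T \<bullet> (Q *v x T)) / 2 - (x 0 \<bullet> (Q *v x 0)) / 2)) {0..T}"
    using steers_energy_balance[OF st U T Q] by (simp only: power_balance[OF J R])
  ultimately show ?thesis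
    unfolding total_cost_def
    using Henstock_Kurzweil_Integration.integral_diff[of ?c "{0..T}" ?d]
    by (simp add: LINT_Ioo_eq_integral set_lebesgue_integral_eq_integral(1) integral_unique)
qed

lemma admissible_imp_steers:
  assumes ad: "admissible A B U T x0 xT u x" and U: "bounded U" "0 \<in> U" and T: "0 \<le> T"
  obtains v where "steers A B U T v x" "x 0 = x0" "x T = xT" "\<And>t. t \<in> {0<..<T} \<Longrightarrow> v t = u t"
proof (rule that)
  show "steers A B U T (\<lambda>t. if t \<in> {0<..<T} then u t else 0) x"
    using ad U T by (intro state_trajectory_imp_steers) (auto simp: admissible_def)
qed (use ad in \<open>auto simp: admissible_def state_trajectory_def\<close>)

lemma strictly_dissipative_supply_cost:
  fixes J R Q :: "real^'n^'n" and B :: "real^'m^'n"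
  assumes J: "transpose J = - J" and R: "pos_semidef R" and Q: "pos_def Q" and U: "bounded U" "0 \<in> U"
  shows "strictly_dissipative (supply_cost B Q) ((J - R) ** Q) B U (matrix_ker (matrix_sqrt R ** Q))"
proof -
  let ?L = "matrix_sqrt R ** Q" and ?A = "(J - R) ** Q"
  let ?V = "matrix_ker ?L"
  have Qt: "transpose Q = Q" using Q by (simp add: pos_def_def)
  have V: "subspace ?V"
    by (auto simp: matrix_ker_def subspace_def matrix_vector_right_distrib matrix_vector_mult_scaleR)
  obtain e where e: "e > 0" "\<And>x. e * infdist x ?V \<le> norm (?L *v x)"
    using matrix_norm_ge_infdist_ker[of ?L] by metis
  \<comment> \<open>Quadratic, with \<open>e\<close> from the lower bound off the kernel, so that
    \<open>\<alpha>\<close> of the distance lies below the dissipation density.\<close>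
  define \<alpha> where "\<alpha> = (\<lambda>s::real. (e * s)\<^sup>2)"
  define S where "S = (\<lambda>x. (x \<bullet> (Q *v x)) / 2)"
  have \<alpha>: "\<alpha> \<in> class_K"
    unfolding class_K_def \<alpha>_def
    using e by (auto intro!: continuous_intros strict_mono_onI power_strict_mono)
  have S: "0 \<le> S x" for x
    using pos_def_imp_pos_semidef[OF Q] by (simp add: S_def pos_semidef_def)
  have "S xT - S x0 \<le> (LINT t:{0<..<T}|lebesgue. supply_cost B Q (x t) (u t) - \<alpha> (infdist (x t) ?V))"
    if T: "T > 0" and opt: "optimal (supply_cost B Q) ?A B U T x0 xT u x" for T x0 xT u x
  proof -
    have "admissible ?A B U T x0 xT u x" using opt by (simp add: optimal_def)
    then obtain v where st: "steers ?A B U T v x" and x: "x 0 = x0" "x T = xT"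
      and vu: "\<And>t. t \<in> {0<..<T} \<Longrightarrow> v t = u t"
      using T admissible_imp_steers[OF _ U] by (metis less_imp_le)
    have cx: "continuous_on {0..T} x" by (rule steers_continuous[OF st])
    have c: "(\<lambda>t. supply_cost B Q (x t) (v t)) absolutely_integrable_on {0..T}"
      by (rule absolutely_integrable_supply_cost[OF st U(1)])
    have d: "(\<lambda>t. \<alpha> (infdist (x t) ?V)) absolutely_integrable_on {0..T}"
      unfolding \<alpha>_def by (intro absolutely_integrable_continuous_real continuous_intros cx)
    have d': "(\<lambda>t. (norm (?L *v x t))\<^sup>2) integrable_on {0..T}"
      by (intro integrable_continuous_real continuous_intros
          bounded_linear.continuous_on[OF matrix_vector_mul_bounded_linear] cx)
    have "integral {0..T} (\<lambda>t. \<alpha> (infdist (x t) ?V)) \<le> integral {0..T} (\<lambda>t. (norm (?L *v x t))\<^sup>2)"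
      using e infdist_nonneg
      by (intro integral_le d' set_lebesgue_integral_eq_integral(1)[OF d])
        (auto simp: \<alpha>_def intro!: power_mono mult_nonneg_nonneg)
    also have "\<dots> = total_cost (supply_cost B Q) T v x - (S xT - S x0)"
      using steers_total_cost[OF J R Qt st U(1)] T x by (simp add: S_def)
    also have "total_cost (supply_cost B Q) T v x = integral {0..T} (\<lambda>t. supply_cost B Q (x t) (v t))"
      unfolding total_cost_def by (rule LINT_Ioo_eq_integral[OF c])
    finally have "S xT - S x0 \<le> integral {0..T} (\<lambda>t. supply_cost B Q (x t) (v t)) - integral {0..T} (\<lambda>t. \<alpha> (infdist (x t) ?V))"
      by simp
    also have "\<dots> = integral {0..T} (\<lambda>t. supply_cost B Q (x t) (v t) - \<alpha> (infdist (x t) ?V))"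
      using c d by (simp add: Henstock_Kurzweil_Integration.integral_diff set_lebesgue_integral_eq_integral(1))
    also have "\<dots> = (LINT t:{0<..<T}|lebesgue. supply_cost B Q (x t) (v t) - \<alpha> (infdist (x t) ?V))"
      using c d by (intro LINT_Ioo_eq_integral[symmetric] set_integral_diff(1))
    also have "\<dots> = (LINT t:{0<..<T}|lebesgue. supply_cost B Q (x t) (u t) - \<alpha> (infdist (x t) ?V))"
      by (rule set_lebesgue_integral_cong) (auto simp: vu)
    finally show ?thesis .
  qed
  then show ?thesis
    unfolding strictly_dissipative_def using V S \<alpha> by blast
qed

section \<open>A competitor whose cost does not depend on the horizon\<close>

lemma supply_cost_bounded:
  fixes Q :: "real^'n^'n" and B :: "real^'m^'n"
  assumes "bounded U"
  obtains c where "c \<ge> 0" "\<And>x u. u \<in> U \<Longrightarrow> supply_cost B Q x u \<le> c * norm x"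
proof -
  have "bounded ((*v) B ` U)" using assms by (simp add: bounded_linear_image)
  then obtain b where b: "b > 0" "\<And>u. u \<in> U \<Longrightarrow> norm (B *v u) \<le> b"
    unfolding bounded_pos by blast
  have bl: "bounded_linear ((*v) Q)" by simp
  show ?thesis
  proof (rule that[of "onorm ((*v) Q) * b"])
    show "0 \<le> onorm ((*v) Q) * b" using b onorm_pos_le[OF bl] by simp
    fix x u assume u: "u \<in> U"
    have "supply_cost B Q x u \<le> norm (Q *v x) * norm (B *v u)"
      unfolding supply_cost_eq by (rule norm_cauchy_schwarz)
    also have "\<dots> \<le> (onorm ((*v) Q) * norm x) * b"
      using b(2)[OF u] onorm[OF bl, of x] onorm_pos_le[OF bl] by (intro mult_mono) auto
    finally show "supply_cost B Q x u \<le> onorm ((*v) Q) * b * norm x" by (simp add: mult_ac)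
  qed
qed

lemma competitor_with_bounded_cost:
  fixes A :: "real^'n^'n" and B :: "real^'m^'n"
  assumes ctr: "controllable A B" and Q: "pos_def Q" and diss: "\<And>x. (Q *v x) \<bullet> (A *v x) \<le> 0"
    and U: "bounded U" "0 \<in> interior U" and reach: "reachable_from_zero A B U xT" and K: "bounded K"
  obtains T0 P where "T0 > 0" "P \<ge> 0"
    "\<And>T x0. T \<ge> T0 \<Longrightarrow> x0 \<in> K \<Longrightarrow> \<exists>v z. admissible A B U T x0 xT v z \<and> total_cost (supply_cost B Q) T v z \<le> P"
proof -
  have U0: "0 \<in> U" using U(2) interior_subset by blast
  obtain \<eta> where \<eta>: "\<eta> > 0" "cball 0 \<eta> \<subseteq> U"
    using U(2) mem_interior_cball by blast
  obtain r where r: "r > 0" "\<And>x. x \<in> K \<Longrightarrow> norm x \<le> r"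
    using K unfolding bounded_pos by blast
  \<comment> \<open>Steering time and state bound come from the radius of \<open>K\<close> alone,
    before the initial value and the horizon are fixed.\<close>
  obtain N D where N: "N > 0" "D \<ge> 0"
    "\<And>b. norm b \<le> r \<Longrightarrow> \<exists>u x. steers A B (cball 0 \<eta>) N u x \<and> x 0 = b \<and> x N = 0 \<and> (\<forall>t\<in>{0..N}. norm (x t) \<le> D)"
    using steer_to_zero[OF ctr Q diss less_imp_le[OF r(1)] \<eta>(1)] by metis
  obtain T2 u2 x2 where T2: "T2 \<ge> 0" and "admissible A B U T2 0 xT u2 x2"
    using reach unfolding reachable_from_zero_def admissible_def by blast
  then obtain v2 where s2: "steers A B U T2 v2 x2" "x2 0 = 0" "x2 T2 = xT"
    using admissible_imp_steers[OF _ U(1) U0] by metis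
  have "bounded (x2 ` {0..T2})"
    by (intro compact_imp_bounded compact_continuous_image steers_continuous[OF s2(1)] compact_Icc)
  then obtain D2 where D2: "D2 > 0" "\<And>t. t \<in> {0..T2} \<Longrightarrow> norm (x2 t) \<le> D2"
    unfolding bounded_pos by blast
  obtain c where c: "c \<ge> 0" "\<And>x u. u \<in> U \<Longrightarrow> supply_cost B Q x u \<le> c * norm x"
    using supply_cost_bounded[OF U(1)] by metis
  show ?thesis
  proof (rule that)
    show "N + T2 > 0" using N T2 by simp
    show "0 \<le> c * D * N + c * D2 * T2" using c N D2 T2 by simp
    fix T x0 assume T: "T \<ge> N + T2" and x0: "x0 \<in> K"
    obtain u1 x1 where s1: "steers A B (cball 0 \<eta>) N u1 x1" "x1 0 = x0" "x1 N = 0"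
      "\<And>t. t \<in> {0..N} \<Longrightarrow> norm (x1 t) \<le> D"
      using N(3)[OF r(2)[OF x0]] by blast
    \<comment> \<open>The resting time absorbs whatever the horizon exceeds the two transfers by; it
      may be zero.\<close>
    define T1 where "T1 = T - N - T2"
    have T1: "T1 \<ge> 0" using T by (simp add: T1_def)
    define u3 where "u3 = (\<lambda>t. if t < T1 then 0 else v2 (t - T1))"
    define x3 where "x3 = (\<lambda>t. if t < T1 then 0 else x2 (t - T1))"
    have s3: "steers A B U (T1 + T2) u3 x3"
      unfolding u3_def x3_def using steers_concat[OF steers_rest[OF U0, of A B T1] s2(1)] s2 T1 T2 by simp
    define v where "v = (\<lambda>t. if t < N then u1 t else u3 (t - N))"
    define z where "z = (\<lambda>t. if t < N then x1 t else x3 (t - N))"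
    have "steers A B U (N + (T1 + T2)) v z"
      unfolding v_def z_def
      by (rule steers_concat[OF steers_mono[OF s1(1) \<eta>(2)] s3])
        (use s1 s2 T1 T2 N in \<open>auto simp: x3_def\<close>)
    then have s: "steers A B U T v z" by (simp add: T1_def)
    have T0: "0 \<le> T" using T N T2 by simp
    have ad: "admissible A B U T x0 xT v z"
      unfolding admissible_def
      using steers_imp_state_trajectory[OF s U(1) T0] s1 s2 N T1 T2
      by (auto simp: z_def x3_def T1_def)
    have vU: "v t \<in> U" for t using s by (simp add: steers_def)
    \<comment> \<open>The supply is bounded by \<open>c\<close> times the norm of the state, so it
      contributes nothing at rest and this majorant only charges the two transfer phases. If they
      meet, both summands count at one point, which is harmless for an upper bound.\<close>
    let ?g = "\<lambda>t. (if t \<in> {0..N} then c * D else 0) + (if t \<in> {T - T2..T} then c * D2 else 0)"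
    have "((\<lambda>t. c * D) has_integral c * D * N) {0..N}"
      using has_integral_const_real[of "c * D" 0 N] N by (simp add: mult.commute)
    then have g1: "((\<lambda>t. if t \<in> {0..N} then c * D else 0) has_integral c * D * N) {0..T}"
      by (subst has_integral_restrict) (use T T2 in auto)
    have "((\<lambda>t. c * D2) has_integral c * D2 * T2) {T - T2..T}"
      using has_integral_const_real[of "c * D2" "T - T2" T] T2 by (simp add: mult.commute)
    then have g2: "((\<lambda>t. if t \<in> {T - T2..T} then c * D2 else 0) has_integral c * D2 * T2) {0..T}"
      by (subst has_integral_restrict) (use T N in auto)
    have le: "supply_cost B Q (z t) (v t) \<le> ?g t" if t: "t \<in> {0..T}" for t
    proof -
      have "norm (z t) \<le> (if t \<in> {0..N} then D else 0) + (if t \<in> {T - T2..T} then D2 else 0)"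
        using t s1(4)[of t] D2(2)[of "t - N - T1"] D2(1) N(2) by (auto simp: z_def x3_def T1_def algebra_simps)
      then have "c * norm (z t) \<le> c * ((if t \<in> {0..N} then D else 0) + (if t \<in> {T - T2..T} then D2 else 0))"
        using c(1) by (rule mult_left_mono)
      also have "\<dots> = ?g t" by (simp add: distrib_left)
      finally show ?thesis using c(2)[OF vU, of "z t" t] by linarith
    qed
    have cost: "(\<lambda>t. supply_cost B Q (z t) (v t)) absolutely_integrable_on {0..T}"
      by (rule absolutely_integrable_supply_cost[OF s U(1)])
    have "total_cost (supply_cost B Q) T v z = integral {0..T} (\<lambda>t. supply_cost B Q (z t) (v t))"
      unfolding total_cost_def by (rule LINT_Ioo_eq_integral[OF cost])
    also have "\<dots> \<le> c * D * N + c * D2 * T2"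
      by (rule has_integral_le[OF integrable_integral has_integral_add[OF g1 g2] le])
        (rule set_lebesgue_integral_eq_integral(1)[OF cost])
    finally show "\<exists>v z. admissible A B U T x0 xT v z \<and> total_cost (supply_cost B Q) T v z \<le> c * D * N + c * D2 * T2"
      using ad by blast
  qed
qed

lemma markov_inequality_integral:
  fixes f :: "real \<Rightarrow> real"
  assumes S: "S \<in> lmeasurable" "S \<subseteq> {a..b}" and f: "f integrable_on {a..b}"
    and "\<And>t. t \<in> {a..b} \<Longrightarrow> 0 \<le> f t" "\<And>t. t \<in> S \<Longrightarrow> c \<le> f t"
  shows "c * measure lebesgue S \<le> integral {a..b} f"
proof -
  have "((\<lambda>_. 1) has_integral measure lebesgue S) S"
    using S(1) by (simp add: has_integral_iff lmeasure_integral lmeasurable_iff_integrable_on)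
  then have "((\<lambda>_. c * 1) has_integral c * measure lebesgue S) S" by (rule has_integral_mult_right)
  then have "((\<lambda>t. if t \<in> S then c else 0) has_integral c * measure lebesgue S) {a..b}"
    using S(2) by (subst has_integral_restrict) auto
  from has_integral_le[OF this integrable_integral[OF f]] show ?thesis using assms(4,5) by simp
qed

theorem theorem16:
  fixes J R Q A :: "real^'n^'n" and B :: "real^'m^'n"
    and u_lo u_hi :: "real^'m" and U :: "(real^'m) set" and V :: "(real^'n) set"
  assumes "transpose J = - J"
    and "pos_semidef R"
    and "pos_def Q"
    and "rank B = CARD('m)"
    and "CARD('m) \<le> CARD('n)"
    and "U = cbox u_lo u_hi"
    and "0 \<in> interior U"
    and "A = (J - R) ** Q"
    and "V = matrix_ker (matrix_sqrt R ** Q)"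
  shows "strictly_dissipative (supply_cost B Q) A B U V \<and>
    (controllable A B \<longrightarrow>
      (\<forall>xT. reachable_from_zero A B U xT \<longrightarrow>
        (\<forall>K \<epsilon>. compact K \<and> \<epsilon> > 0 \<longrightarrow>
          (\<exists>C>0. \<forall>T>0. \<forall>x0\<in>K. \<forall>u x. optimal (supply_cost B Q) A B U T x0 xT u x \<longrightarrow>
             measure lebesgue {t \<in> {0..T}. infdist (x t) V \<ge> \<epsilon>} < C))))"
proof (intro conjI impI allI)
  have U: "bounded U" "0 \<in> U"
    using assms(6) subsetD[OF interior_subset assms(7)] by auto
  show "strictly_dissipative (supply_cost B Q) A B U V"
    unfolding assms(8,9) by (rule strictly_dissipative_supply_cost[OF assms(1-3) U])
  fix xT and K :: "(real^'n) set" and \<epsilon> :: real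
  assume ctr: "controllable A B" and reach: "reachable_from_zero A B U xT" and "compact K \<and> \<epsilon> > 0"
  then have K: "compact K" "bounded K" and \<epsilon>: "\<epsilon> > 0" by (auto simp: compact_imp_bounded)
  let ?L = "matrix_sqrt R ** Q"
  have Qt: "transpose Q = Q" using assms(3) by (simp add: pos_def_def)
  have Qpos: "0 \<le> x \<bullet> (Q *v x)" for x
    using pos_def_imp_pos_semidef[OF assms(3)] by (simp add: pos_semidef_def)
  \<comment> \<open>With zero input the balance leaves only the dissipation: the uncontrolled system
    is passive.\<close>
  have diss: "(Q *v x) \<bullet> (A *v x) \<le> 0" for x
    using power_balance[OF assms(1,2), of Q x B 0] by (simp add: assms(8) supply_cost_def)
  obtain T0 P where T0: "T0 > 0" "P \<ge> 0"
    "\<And>T x0. T \<ge> T0 \<Longrightarrow> x0 \<in> K \<Longrightarrow> \<exists>v z. admissible A B U T x0 xT v z \<and> total_cost (supply_cost B Q) T v z \<le> P"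
    using competitor_with_bounded_cost[OF ctr assms(3) diss U(1) assms(7) reach K(2)] by metis
  obtain e where e: "e > 0" "\<And>x. e * infdist x V \<le> norm (?L *v x)"
    using matrix_norm_ge_infdist_ker[of ?L] unfolding assms(9) by metis
  have "bounded ((\<lambda>x. (x \<bullet> (Q *v x)) / 2) ` K)"
    using K(1) by (intro compact_imp_bounded compact_continuous_image continuous_intros) auto
  then obtain h where h: "h > 0" "\<And>x. x \<in> K \<Longrightarrow> (x \<bullet> (Q *v x)) / 2 \<le> h"
    unfolding bounded_pos by (force simp: Qpos)
  \<comment> \<open>The quotient is the Markov bound: total dissipation at most
    \<open>P + h\<close>, density at least \<open>(e * \<epsilon>)\<^sup>2\<close> on the set.
    Adding \<open>T0\<close> settles horizons too short for the competitor, where the measure is at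
    most \<open>T\<close>, and makes the inequality strict otherwise.\<close>
  define C where "C = (P + h) / (e * \<epsilon>)\<^sup>2 + T0"
  show "\<exists>C>0. \<forall>T>0. \<forall>x0\<in>K. \<forall>u x. optimal (supply_cost B Q) A B U T x0 xT u x \<longrightarrow>
             measure lebesgue {t \<in> {0..T}. infdist (x t) V \<ge> \<epsilon>} < C"
  proof (intro exI[of _ C] conjI allI impI ballI)
    have quot: "0 \<le> (P + h) / (e * \<epsilon>)\<^sup>2" using T0 h by simp
    then show "C > 0" using T0 by (simp add: C_def)
    fix T x0 u x
    assume T: "(T::real) > 0" and x0: "x0 \<in> K" and opt: "optimal (supply_cost B Q) A B U T x0 xT u x"
    let ?\<Omega> = "{t \<in> {0..T}. infdist (x t) V \<ge> \<epsilon>}"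
    have "admissible A B U T x0 xT u x" using opt by (simp add: optimal_def)
    then obtain v where st: "steers A B U T v x" and x: "x 0 = x0" "x T = xT"
      and vu: "\<And>t. t \<in> {0<..<T} \<Longrightarrow> v t = u t"
      using T admissible_imp_steers[OF _ U] by (metis less_imp_le)
    have cx: "continuous_on {0..T} x" by (rule steers_continuous[OF st])
    have "closed ?\<Omega>"
      using continuous_closed_preimage[of "{0..T}" "\<lambda>t. infdist (x t) V" "{\<epsilon>..}"]
      by (auto simp: vimage_def Int_def intro!: continuous_intros cx)
    then have \<Omega>: "?\<Omega> \<in> lmeasurable"
      by (intro lmeasurable_compact) (auto simp: compact_eq_bounded_closed intro: bounded_subset[OF bounded_closed_interval])
    show "measure lebesgue ?\<Omega> < C"
    proof (cases "T < T0")
      case True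
      have "measure lebesgue ?\<Omega> \<le> measure lebesgue {0..T}"
        by (rule measure_mono_fmeasurable) (use \<Omega> in auto)
      also have "\<dots> = T" using T by simp
      finally show ?thesis using True quot by (simp add: C_def)
    next
      case False
      then obtain w z where "admissible A B U T x0 xT w z" "total_cost (supply_cost B Q) T w z \<le> P"
        using T0(3)[of T x0] x0 by auto
      then have "total_cost (supply_cost B Q) T u x \<le> P"
        using opt unfolding optimal_def by force
      moreover have "total_cost (supply_cost B Q) T u x = total_cost (supply_cost B Q) T v x"
        unfolding total_cost_def by (rule set_lebesgue_integral_cong) (auto simp: vu)
      ultimately have cost: "total_cost (supply_cost B Q) T v x \<le> P" by simp
      have "(e * \<epsilon>)\<^sup>2 * measure lebesgue ?\<Omega> \<le> integral {0..T} (\<lambda>t. (norm (?L *v x t))\<^sup>2)"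
      proof (rule markov_inequality_integral[OF \<Omega>])
        show "(\<lambda>t. (norm (?L *v x t))\<^sup>2) integrable_on {0..T}"
          by (intro integrable_continuous_real continuous_intros
              bounded_linear.continuous_on[OF matrix_vector_mul_bounded_linear] cx)
        fix t assume "t \<in> ?\<Omega>"
        then have "e * \<epsilon> \<le> e * infdist (x t) V" using e(1) by auto
        also have "\<dots> \<le> norm (?L *v x t)" by (rule e(2))
        finally show "(e * \<epsilon>)\<^sup>2 \<le> (norm (?L *v x t))\<^sup>2" using e(1) \<epsilon> by (intro power_mono) auto
      qed auto
      \<comment> \<open>The dissipation is the cost minus the storage at \<open>xT\<close> plus the
        storage at \<open>x0\<close>: the cost is at most \<open>P\<close>, the terminal storage is
        nonnegative and dropped, and \<open>h\<close> bounds the initial one on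
        \<open>K\<close>.\<close>
      also have "\<dots> \<le> P + h"
        using steers_total_cost[OF assms(1,2) Qt st[unfolded assms(8)] U(1)] T cost Qpos[of xT] h(2)[OF x0]
        by (simp add: x)
      finally have "measure lebesgue ?\<Omega> \<le> (P + h) / (e * \<epsilon>)\<^sup>2"
        using e(1) \<epsilon> by (simp add: pos_le_divide_eq mult.commute)
      then show ?thesis using T0 by (simp add: C_def)
    qed
  qed
qed

end
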